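(* Let $A$ be a special biserial algebra with fixed permissible data $(O,N,C,\dagger)$, and let $\mathbf p$ be an injective syllable. If $\mathbf p\nabla^r$ is defined for all $r\ge 0$, then the forward orbit $(\mathbf p\nabla^r)_{r\ge0}$ has no tail $(\mathbf p\nabla^r)_{r\gg0}$ containing only interior syllables. Here $\nabla$ denotes the descent operation on syllables.
   Context: Conventions: $k$ is an algebraically closed field; paths are read left to right; $s(p),t(p),\mathrm{len}\,p$ denote source, target and length of a path. Special biserial (SB) algebra: $A=kQ/I$ with $Q$ a finite quiver, $I$ an admissible ideal, such that every vertex of $Q$ is the source of at most two and the target of at most two arrows, and for each arrow $\alpha$ there is at most one arrow $\beta$ with $\alpha\beta\notin I$ and at most one arrow $\gamma$ with $\gamma\alpha\notin I$. $I$ is generated by paths and by (skew) commutativity relations $\lambda p-\mu q$ ($\lambda,\mu\neq0$, $p\ne q$ paths). Permissible data. Choose a $2$-regular quiver $\widetilde Q$ (each vertex is the source of exactly two and the target of exactly two arrows) obtained from $Q$ by adding arrows only; arrows of $\widetilde Q$ not in $Q$ have $A$-residue $0$, other arrows and vertices have their usual residue in $A$, and residues of paths of $\widetilde Q$ are defined multiplicatively. An overquiver is a surjective quiver homomorphism $O\to\widetilde Q$ with $O$ a $1$-regular quiver (each vertex is the source of exactly one and the target of exactly one arrow; $O$ need not be connected) having $2|Q_0|$ vertices, bijective on arrows, exactly $2$-to-$1$ on vertices, and such that every path of $\widetilde Q$ with nonzero $A$-residue is the image of a path of $O$. The $A$-residue of a path of $O$ is the residue of its image in $\widetilde Q$.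 The map $\dagger:O_0\to O_0$ is the involution exchanging the two vertices with common image in $Q$. $N$ is the set of paths of $O$ with nonzero $A$-residue. $C\subseteq N$ is the set of paths in $N$ (called components) whose residue is linearly dependent on that of another path in $N$ with a different image in $\widetilde Q$ (i.e. lifts of the two components of commutativity relations); $\dagger$ also denotes the involution on $C$ exchanging the two components of each commutativity relation. Encodings. For $i\in O_0$: $a_i=\max\{\mathrm{len}\,p: p\in N,\ s(p)=i\}$; $b_i=0$ if some $p\in C$ has $s(p)=i$, and $b_i=1$ otherwise; $c_i=\max\{\mathrm{len}\,p:p\in N,\ t(p)=i\}$; $d_i=0$ if some $p\in C$ has $t(p)=i$, and $d_i=1$ otherwise. For $i\in O_0$ and an integer $r\ge0$, $i-r$ denotes the target of the unique path of $O$ of length $r$ with source $i$. Syllables. A syllable is a triple $(p,\varepsilon,\sigma)$ with $p\in N\setminus C$, $\varepsilon\in\{0,1\}$, $\sigma\in\{+1,-1\}$ (the orientation) and $0<\mathrm{len}\,p+\varepsilon$. It is interior if $\varepsilon=0$ and boundary if $\varepsilon=1$. Since a path of $O$ is determined by its source and length, a syllable with $s(p)=i$, $\mathrm{len}\,p=\ell$ is also written $(i,\ell,\varepsilon)^\sigma$. An injective syllable is a syllable whose underlying path $p$ has target $i$ and length $c_i$ for some $i\in O_0$ with $d_i=1$ (and $\varepsilon\in\{0,1\}$ arbitrary). Descent. The partial operation $\nabla$ on syllables is given by $(i,\ell,\varepsilon)^\sigma\nabla=(i-(\ell+\varepsilon),\,a_i-(\ell+\varepsilon),\,b_i)^{-\sigma}$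 whenever the right-hand side is a syllable, and is undefined otherwise. *)

theory Defs
  imports
    "Graph_Theory.Arc_Walk"
    "HOL-Algebra.QuotRing"
    "HOL-Algebra.Ideal_Product"
    "HOL-Library.Poly_Mapping"
    "HOL-Computational_Algebra.Polynomial"
begin

section \<open>Quivers and paths\<close>

text \<open>A quiver is a \<^locale>\<open>wf_digraph\<close>. The start vertex is part of a path, so that there is a
  stationary path \<open>(v, [])\<close> at each vertex \<open>v\<close>. The list gives the arrows in the order in which
  they are traversed (paths are read left to right).\<close>

type_synonym ('v, 'e) path = "'v \<times> 'e list"

definition src :: "('v, 'e) path \<Rightarrow> 'v" where
  "src p = fst p"

definition tgt :: "('v, 'e) pre_digraph \<Rightarrow> ('v, 'e) path \<Rightarrow> 'v" where
  "tgt Q p = last (pre_digraph.awalk_verts Q (fst p) (snd p))"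

definition len :: "('v, 'e) path \<Rightarrow> nat" where
  "len p = length (snd p)"

definition paths :: "('v, 'e) pre_digraph \<Rightarrow> ('v, 'e) path set" where
  "paths Q = {p. pre_digraph.awalk Q (src p) (snd p) (tgt Q p)}"

definition regular_quiver :: "nat \<Rightarrow> ('v, 'e) pre_digraph \<Rightarrow> bool" where
  "regular_quiver n Q \<longleftrightarrow> fin_digraph Q \<and>
     (\<forall>v \<in> verts Q. out_degree Q v = n \<and> in_degree Q v = n)"


section \<open>The path algebra\<close>

definition path_mult ::
    "('v, 'e) pre_digraph \<Rightarrow> (('v, 'e) path \<Rightarrow>\<^sub>0 'k::field) \<Rightarrow> (('v, 'e) path \<Rightarrow>\<^sub>0 'k) \<Rightarrow>
     (('v, 'e) path \<Rightarrow>\<^sub>0 'k)" where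
  "path_mult Q x y = (\<Sum>p \<in> Poly_Mapping.keys x. \<Sum>q \<in> Poly_Mapping.keys y.
     if tgt Q p = src q
     then Poly_Mapping.single (src p, snd p @ snd q)
            (Poly_Mapping.lookup x p * Poly_Mapping.lookup y q)
     else 0)"

definition path_scalar :: "('v, 'e) pre_digraph \<Rightarrow> 'k::field \<Rightarrow> (('v, 'e) path \<Rightarrow>\<^sub>0 'k)" where
  "path_scalar Q c = (\<Sum>v \<in> verts Q. Poly_Mapping.single (v, []) c)"

definition path_algebra :: "('v, 'e) pre_digraph \<Rightarrow> (('v, 'e) path \<Rightarrow>\<^sub>0 'k::field) ring" where
  "path_algebra Q = \<lparr>carrier = {x. Poly_Mapping.keys x \<subseteq> paths Q}, monoid.mult = path_mult Q,
     one = path_scalar Q 1, zero = 0, add = (+)\<rparr>"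

definition path_elem :: "('v, 'e) path \<Rightarrow> (('v, 'e) path \<Rightarrow>\<^sub>0 'k::field)" where
  "path_elem p = Poly_Mapping.single p 1"

lemma tgt_append:
  assumes "tgt Q p = src q"
  shows "tgt Q (src p, snd p @ snd q) = tgt Q q"
  using assms by (auto simp: tgt_def src_def pre_digraph.awalk_verts_conv)

lemma path_mult_superset:
  assumes "finite A" "finite B" "Poly_Mapping.keys x \<subseteq> A" "Poly_Mapping.keys y \<subseteq> B"
  shows "path_mult Q x y = (\<Sum>p \<in> A. \<Sum>q \<in> B.
     if tgt Q p = src q
     then Poly_Mapping.single (src p, snd p @ snd q)
            (Poly_Mapping.lookup x p * Poly_Mapping.lookup y q)
     else 0)"
  unfolding path_mult_def
  apply (rule sum.mono_neutral_cong_left[OF assms(1,3)])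
   apply (auto simp: in_keys_iff intro!: sum.neutral)[1]
  apply (rule sum.mono_neutral_left[OF assms(2,4)])
  apply (auto simp: in_keys_iff)
  done

lemma path_mult_add_left: "path_mult Q (x + y) z = path_mult Q x z + path_mult Q y z"
proof -
  let ?A = "Poly_Mapping.keys x \<union> Poly_Mapping.keys y"
  have "Poly_Mapping.keys (x + y) \<subseteq> ?A" by (rule Poly_Mapping.keys_add)
  then show ?thesis
    by (simp add: path_mult_superset[of ?A "Poly_Mapping.keys z"] flip: sum.distrib)
      (intro sum.cong refl,
        auto simp: Poly_Mapping.lookup_add distrib_right Poly_Mapping.single_add)
qed

lemma path_mult_add_right: "path_mult Q z (x + y) = path_mult Q z x + path_mult Q z y"
proof -
  let ?A = "Poly_Mapping.keys x \<union> Poly_Mapping.keys y"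
  have "Poly_Mapping.keys (x + y) \<subseteq> ?A" by (rule Poly_Mapping.keys_add)
  then show ?thesis
    by (simp add: path_mult_superset[of "Poly_Mapping.keys z" ?A] flip: sum.distrib)
      (intro sum.cong refl,
        auto simp: Poly_Mapping.lookup_add distrib_left Poly_Mapping.single_add)
qed

lemma path_mult_zero [simp]: "path_mult Q 0 x = 0" "path_mult Q x 0 = 0"
  by (simp_all add: path_mult_def)

lemma path_mult_single:
  "path_mult Q (Poly_Mapping.single p c) (Poly_Mapping.single q d) =
     (if tgt Q p = src q then Poly_Mapping.single (src p, snd p @ snd q) (c * d) else 0)"
  by (subst path_mult_superset[of "{p}" "{q}"]) auto

lemma path_mult_sum_left: "path_mult Q (sum f A) y = (\<Sum>a \<in> A. path_mult Q (f a) y)"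
  by (induction A rule: infinite_finite_induct) (auto simp: path_mult_add_left)

lemma path_mult_sum_right: "path_mult Q y (sum f A) = (\<Sum>a \<in> A. path_mult Q y (f a))"
  by (induction A rule: infinite_finite_induct) (auto simp: path_mult_add_right)

lemma poly_mapping_sum_monomials:
  fixes x :: "'a \<Rightarrow>\<^sub>0 'b::comm_monoid_add"
  shows "(\<Sum>p \<in> Poly_Mapping.keys x. Poly_Mapping.single p (Poly_Mapping.lookup x p)) = x"
  by (rule poly_mapping_eqI)
    (auto simp: Poly_Mapping.lookup_sum Poly_Mapping.lookup_single when_def in_keys_iff)

lemma poly_mapping_induct [case_names single add]:
  fixes x :: "'a \<Rightarrow>\<^sub>0 'b::comm_monoid_add"
  assumes "\<And>p c. P (Poly_Mapping.single p c)" and "\<And>x y. P x \<Longrightarrow> P y \<Longrightarrow> P (x + y)"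
  shows "P x"
proof -
  have "P (\<Sum>p \<in> A. Poly_Mapping.single p (f p))" for A and f :: "'a \<Rightarrow> 'b"
    by (induction A rule: infinite_finite_induct)
      (use assms assms(1)[of undefined 0] in auto)
  from this[of "Poly_Mapping.lookup x" "Poly_Mapping.keys x"] show ?thesis
    by (simp add: poly_mapping_sum_monomials)
qed

lemma path_mult_assoc: "path_mult Q (path_mult Q x y) z = path_mult Q x (path_mult Q y z)"
proof (induction x rule: poly_mapping_induct)
  case (single p c)
  show ?case
  proof (induction y rule: poly_mapping_induct)
    case (single q d)
    show ?case
    proof (induction z rule: poly_mapping_induct)
      case (single r e)
      show ?case
        by (auto simp: path_mult_single tgt_append mult.assoc) (auto simp: src_def)
    qed (simp add: path_mult_add_right)
  qed (simp add: path_mult_add_left path_mult_add_right)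
qed (simp add: path_mult_add_left)

lemma tgt_in_verts: "wf_digraph Q \<Longrightarrow> p \<in> paths Q \<Longrightarrow> tgt Q p \<in> verts Q"
  by (auto simp: paths_def dest: wf_digraph.awalk_last_in_verts)

lemma path_append_in_paths:
  assumes "wf_digraph Q" "p \<in> paths Q" "q \<in> paths Q" "tgt Q p = src q"
  shows "(src p, snd p @ snd q) \<in> paths Q"
  using assms wf_digraph.awalk_appendI[OF assms(1), of "src p" "snd p" "src q" "snd q" "tgt Q q"]
  by (simp add: paths_def tgt_append) (simp add: src_def)

lemma path_algebra_ring:
  assumes "fin_digraph Q"
  shows "ring (path_algebra Q :: (('v, 'e) path \<Rightarrow>\<^sub>0 'k::field) ring)"
proof -
  interpret fin_digraph Q by fact
  have stationary: "(v, []) \<in> paths Q" if "v \<in> verts Q" for v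
    using that by (simp add: paths_def src_def tgt_def awalk_def)
  have closed: "Poly_Mapping.keys (path_mult Q x y) \<subseteq> paths Q"
    if "Poly_Mapping.keys x \<subseteq> paths Q" "Poly_Mapping.keys y \<subseteq> paths Q"
    for x y :: "('v, 'e) path \<Rightarrow>\<^sub>0 'k"
    unfolding path_mult_def using that
    by (intro order.trans[OF Poly_Mapping.keys_sum] UN_least)
      (auto intro!: path_append_in_paths wf_digraph split: if_splits)
  have scalar: "Poly_Mapping.keys (path_scalar Q (1::'k)) \<subseteq> paths Q"
    unfolding path_scalar_def
    by (intro order.trans[OF Poly_Mapping.keys_sum] UN_least) (auto intro: stationary)
  have left: "path_mult Q (path_scalar Q 1) x = x"
    if "Poly_Mapping.keys x \<subseteq> paths Q" for x :: "('v, 'e) path \<Rightarrow>\<^sub>0 'k"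
  proof -
    have "path_mult Q (path_scalar Q 1) (Poly_Mapping.single p (Poly_Mapping.lookup x p)) =
      Poly_Mapping.single p (Poly_Mapping.lookup x p)" if "p \<in> Poly_Mapping.keys x" for p
    proof -
      have "src p \<in> verts Q"
        using that \<open>Poly_Mapping.keys x \<subseteq> paths Q\<close> by (auto simp: paths_def awalk_def)
      then show ?thesis
        by (simp add: path_scalar_def path_mult_sum_left path_mult_single tgt_def sum.delta'
            flip: src_def) (simp add: src_def)
    qed
    then show ?thesis
      by (subst (1 2) poly_mapping_sum_monomials[symmetric]) (simp add: path_mult_sum_right)
  qed
  have right: "path_mult Q x (path_scalar Q 1) = x"
    if "Poly_Mapping.keys x \<subseteq> paths Q" for x :: "('v, 'e) path \<Rightarrow>\<^sub>0 'k"
  proof -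
    have "path_mult Q (Poly_Mapping.single p (Poly_Mapping.lookup x p)) (path_scalar Q 1) =
      Poly_Mapping.single p (Poly_Mapping.lookup x p)" if "p \<in> Poly_Mapping.keys x" for p
    proof -
      have "tgt Q p \<in> verts Q"
        using that \<open>Poly_Mapping.keys x \<subseteq> paths Q\<close> by (auto intro: tgt_in_verts wf_digraph)
      then show ?thesis
        by (simp add: path_scalar_def path_mult_sum_right path_mult_single src_def sum.delta)
    qed
    then show ?thesis
      by (subst (1 2) poly_mapping_sum_monomials[symmetric]) (simp add: path_mult_sum_left)
  qed
  show ?thesis
  proof (intro ringI abelian_groupI monoidI)
    fix x :: "('v, 'e) path \<Rightarrow>\<^sub>0 'k"
    assume "x \<in> carrier (path_algebra Q)"
    then show "\<exists>y \<in> carrier (path_algebra Q). y \<oplus>\<^bsub>path_algebra Q\<^esub> x = \<zero>\<^bsub>path_algebra Q\<^esub>"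
      by (intro bexI[of _ "- x"]) (auto simp: path_algebra_def)
  qed (use closed scalar left right Poly_Mapping.keys_add in
      \<open>auto simp: path_algebra_def path_mult_assoc path_mult_add_left path_mult_add_right
        add_ac dest: subsetD[OF Poly_Mapping.keys_add]\<close>)
qed


section \<open>Special biserial algebras\<close>

definition arrow_ideal :: "('v, 'e) pre_digraph \<Rightarrow> (('v, 'e) path \<Rightarrow>\<^sub>0 'k::field) set" where
  "arrow_ideal Q = Idl\<^bsub>path_algebra Q\<^esub> ((\<lambda>\<alpha>. path_elem (tail Q \<alpha>, [\<alpha>])) ` arcs Q)"

definition admissible_ideal ::
    "('v, 'e) pre_digraph \<Rightarrow> (('v, 'e) path \<Rightarrow>\<^sub>0 'k::field) set \<Rightarrow> bool" where
  "admissible_ideal Q I \<longleftrightarrow> ideal I (path_algebra Q) \<and>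
     (\<exists>m \<ge> 2. arrow_ideal Q [^]\<^bsub>ideals_set (path_algebra Q)\<^esub> (m::nat) \<subseteq> I) \<and>
     I \<subseteq> arrow_ideal Q [^]\<^bsub>ideals_set (path_algebra Q)\<^esub> (2::nat)"

definition skew_commutativity_relations ::
    "('v, 'e) pre_digraph \<Rightarrow> (('v, 'e) path \<Rightarrow>\<^sub>0 'k::field) set" where
  "skew_commutativity_relations Q =
     {Poly_Mapping.single p c - Poly_Mapping.single q d | p q c d.
        p \<in> paths Q \<and> q \<in> paths Q \<and> p \<noteq> q \<and> c \<noteq> 0 \<and> d \<noteq> 0}"

definition special_biserial ::
    "('v, 'e) pre_digraph \<Rightarrow> (('v, 'e) path \<Rightarrow>\<^sub>0 'k::field) set \<Rightarrow> bool" where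
  "special_biserial Q I \<longleftrightarrow>
     fin_digraph Q \<and> admissible_ideal Q I \<and>
     (\<forall>v \<in> verts Q. out_degree Q v \<le> 2 \<and> in_degree Q v \<le> 2) \<and>
     (\<forall>\<alpha> \<in> arcs Q.
        (\<forall>\<beta> \<in> arcs Q. \<forall>\<beta>' \<in> arcs Q.
           (tail Q \<alpha>, [\<alpha>, \<beta>]) \<in> paths Q \<and> path_elem (tail Q \<alpha>, [\<alpha>, \<beta>]) \<notin> I \<and>
           (tail Q \<alpha>, [\<alpha>, \<beta>']) \<in> paths Q \<and> path_elem (tail Q \<alpha>, [\<alpha>, \<beta>']) \<notin> I \<longrightarrow> \<beta> = \<beta>') \<and>
        (\<forall>\<gamma> \<in> arcs Q. \<forall>\<gamma>' \<in> arcs Q.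
           (tail Q \<gamma>, [\<gamma>, \<alpha>]) \<in> paths Q \<and> path_elem (tail Q \<gamma>, [\<gamma>, \<alpha>]) \<notin> I \<and>
           (tail Q \<gamma>', [\<gamma>', \<alpha>]) \<in> paths Q \<and> path_elem (tail Q \<gamma>', [\<gamma>', \<alpha>]) \<notin> I \<longrightarrow> \<gamma> = \<gamma>')) \<and>
     (\<exists>S \<subseteq> path_elem ` paths Q \<union> skew_commutativity_relations Q.
        I = Idl\<^bsub>path_algebra Q\<^esub> S)"


section \<open>Permissible data\<close>

text \<open>The algebra is \<open>A = kQ/I\<close> with \<open>Q = quiver D\<close> and \<open>I = relations D\<close>; the overquiver
  \<open>overquiver D\<close> maps to \<open>ext_quiver D\<close>, the 2-regular quiver obtained from \<open>Q\<close> by adding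
  arrows. The involutions on the vertices of the overquiver and on the components are determined by
  these data and do not enter the descent operation, so they are not recorded.\<close>

record (overloaded) ('v, 'e, 'w, 'b, 'k) perm_data =
  quiver :: "('v, 'e) pre_digraph"
  relations :: "(('v, 'e) path \<Rightarrow>\<^sub>0 'k) set"
  ext_quiver :: "('v, 'e) pre_digraph"
  overquiver :: "('w, 'b) pre_digraph"
  vert_map :: "'w \<Rightarrow> 'v"
  arc_map :: "'b \<Rightarrow> 'e"

definition alg ::
    "('v, 'e, 'w, 'b, 'k::field) perm_data \<Rightarrow> (('v, 'e) path \<Rightarrow>\<^sub>0 'k) set ring" where
  "alg D = path_algebra (quiver D) Quot relations D"

definition vert_residue ::
    "('v, 'e, 'w, 'b, 'k::field) perm_data \<Rightarrow> 'v \<Rightarrow> (('v, 'e) path \<Rightarrow>\<^sub>0 'k) set" where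
  "vert_residue D v = relations D +>\<^bsub>path_algebra (quiver D)\<^esub> path_elem (v, [])"

definition arrow_residue ::
    "('v, 'e, 'w, 'b, 'k::field) perm_data \<Rightarrow> 'e \<Rightarrow> (('v, 'e) path \<Rightarrow>\<^sub>0 'k) set" where
  "arrow_residue D \<alpha> =
     (if \<alpha> \<in> arcs (quiver D)
      then relations D +>\<^bsub>path_algebra (quiver D)\<^esub> path_elem (tail (quiver D) \<alpha>, [\<alpha>])
      else \<zero>\<^bsub>alg D\<^esub>)"

definition residue ::
    "('v, 'e, 'w, 'b, 'k::field) perm_data \<Rightarrow> ('v, 'e) path \<Rightarrow> (('v, 'e) path \<Rightarrow>\<^sub>0 'k) set" where
  "residue D p =
     foldl (\<lambda>x \<alpha>. x \<otimes>\<^bsub>alg D\<^esub> arrow_residue D \<alpha>) (vert_residue D (src p)) (snd p)"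

definition path_image ::
    "('v, 'e, 'w, 'b, 'k::field) perm_data \<Rightarrow> ('w, 'b) path \<Rightarrow> ('v, 'e) path" where
  "path_image D p = (vert_map D (src p), map (arc_map D) (snd p))"

definition permissible_data :: "('v, 'e, 'w, 'b, 'k::field) perm_data \<Rightarrow> bool" where
  "permissible_data D \<longleftrightarrow>
     regular_quiver 2 (ext_quiver D) \<and>
     verts (ext_quiver D) = verts (quiver D) \<and>
     arcs (quiver D) \<subseteq> arcs (ext_quiver D) \<and>
     (\<forall>\<alpha> \<in> arcs (quiver D). tail (ext_quiver D) \<alpha> = tail (quiver D) \<alpha> \<and>
        head (ext_quiver D) \<alpha> = head (quiver D) \<alpha>) \<and>
     regular_quiver 1 (overquiver D) \<and>
     card (verts (overquiver D)) = 2 * card (verts (quiver D)) \<and>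
     vert_map D ` verts (overquiver D) = verts (ext_quiver D) \<and>
     (\<forall>v \<in> verts (ext_quiver D). card {i \<in> verts (overquiver D). vert_map D i = v} = 2) \<and>
     bij_betw (arc_map D) (arcs (overquiver D)) (arcs (ext_quiver D)) \<and>
     (\<forall>\<alpha> \<in> arcs (overquiver D).
        tail (ext_quiver D) (arc_map D \<alpha>) = vert_map D (tail (overquiver D) \<alpha>) \<and>
        head (ext_quiver D) (arc_map D \<alpha>) = vert_map D (head (overquiver D) \<alpha>)) \<and>
     (\<forall>p \<in> paths (ext_quiver D). residue D p \<noteq> \<zero>\<^bsub>alg D\<^esub> \<longrightarrow>
        (\<exists>p' \<in> paths (overquiver D). path_image D p' = p))"

definition nonzero_paths :: "('v, 'e, 'w, 'b, 'k::field) perm_data \<Rightarrow> ('w, 'b) path set" where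
  "nonzero_paths D = {p \<in> paths (overquiver D). residue D (path_image D p) \<noteq> \<zero>\<^bsub>alg D\<^esub>}"

text \<open>Scalars act on the quotient algebra through the central embedding of the field.\<close>

definition scale ::
    "('v, 'e, 'w, 'b, 'k::field) perm_data \<Rightarrow> 'k \<Rightarrow> (('v, 'e) path \<Rightarrow>\<^sub>0 'k) set \<Rightarrow>
     (('v, 'e) path \<Rightarrow>\<^sub>0 'k) set" where
  "scale D c x =
     (relations D +>\<^bsub>path_algebra (quiver D)\<^esub> path_scalar (quiver D) c) \<otimes>\<^bsub>alg D\<^esub> x"

definition linearly_dependent ::
    "('v, 'e, 'w, 'b, 'k::field) perm_data \<Rightarrow> (('v, 'e) path \<Rightarrow>\<^sub>0 'k) set \<Rightarrow>
     (('v, 'e) path \<Rightarrow>\<^sub>0 'k) set \<Rightarrow> bool" where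
  "linearly_dependent D x y \<longleftrightarrow>
     (\<exists>c d. (c \<noteq> 0 \<or> d \<noteq> 0) \<and> scale D c x \<oplus>\<^bsub>alg D\<^esub> scale D d y = \<zero>\<^bsub>alg D\<^esub>)"

definition components :: "('v, 'e, 'w, 'b, 'k::field) perm_data \<Rightarrow> ('w, 'b) path set" where
  "components D = {p \<in> nonzero_paths D. \<exists>q \<in> nonzero_paths D. path_image D p \<noteq> path_image D q \<and>
     linearly_dependent D (residue D (path_image D p)) (residue D (path_image D q))}"


section \<open>Encodings, syllables and descent\<close>

definition enc_a :: "('v, 'e, 'w, 'b, 'k::field) perm_data \<Rightarrow> 'w \<Rightarrow> nat" where
  "enc_a D i = Max {len p | p. p \<in> nonzero_paths D \<and> src p = i}"

definition enc_b :: "('v, 'e, 'w, 'b, 'k::field) perm_data \<Rightarrow> 'w \<Rightarrow> nat" where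
  "enc_b D i = (if \<exists>p \<in> components D. src p = i then 0 else 1)"

definition enc_c :: "('v, 'e, 'w, 'b, 'k::field) perm_data \<Rightarrow> 'w \<Rightarrow> nat" where
  "enc_c D i = Max {len p | p. p \<in> nonzero_paths D \<and> tgt (overquiver D) p = i}"

definition enc_d :: "('v, 'e, 'w, 'b, 'k::field) perm_data \<Rightarrow> 'w \<Rightarrow> nat" where
  "enc_d D i = (if \<exists>p \<in> components D. tgt (overquiver D) p = i then 0 else 1)"

definition path_from :: "('v, 'e, 'w, 'b, 'k::field) perm_data \<Rightarrow> 'w \<Rightarrow> nat \<Rightarrow> ('w, 'b) path" where
  "path_from D i r = (THE p. p \<in> paths (overquiver D) \<and> src p = i \<and> len p = r)"

text \<open>\<open>shift D i r\<close> is the vertex written \<open>i - r\<close> on paper.\<close>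

definition shift :: "('v, 'e, 'w, 'b, 'k::field) perm_data \<Rightarrow> 'w \<Rightarrow> nat \<Rightarrow> 'w" where
  "shift D i r = tgt (overquiver D) (path_from D i r)"

type_synonym ('w, 'b) triple = "('w, 'b) path \<times> nat \<times> int"

definition syllable :: "('v, 'e, 'w, 'b, 'k::field) perm_data \<Rightarrow> ('w, 'b) triple \<Rightarrow> bool" where
  "syllable D = (\<lambda>(p, \<epsilon>, \<sigma>).
     p \<in> nonzero_paths D - components D \<and> \<epsilon> \<in> {0, 1} \<and> \<sigma> \<in> {1, - 1} \<and> 0 < len p + \<epsilon>)"

definition interior :: "('w, 'b) triple \<Rightarrow> bool" where
  "interior = (\<lambda>(p, \<epsilon>, \<sigma>). \<epsilon> = 0)"

definition injective_syllable ::
    "('v, 'e, 'w, 'b, 'k::field) perm_data \<Rightarrow> ('w, 'b) triple \<Rightarrow> bool" where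
  "injective_syllable D s \<longleftrightarrow> syllable D s \<and>
     (\<exists>i \<in> verts (overquiver D). enc_d D i = 1 \<and>
        tgt (overquiver D) (fst s) = i \<and> len (fst s) = enc_c D i)"

text \<open>The guard \<open>len p + \<epsilon> \<le> enc_a D i\<close> is part of the requirement that the right-hand side is a
  syllable: the subtraction below is on \<^typ>\<open>nat\<close>, whereas a negative length gives no syllable.\<close>

definition descent ::
    "('v, 'e, 'w, 'b, 'k::field) perm_data \<Rightarrow> ('w, 'b) triple \<Rightarrow> ('w, 'b) triple option" where
  "descent D = (\<lambda>(p, \<epsilon>, \<sigma>).
     let i = src p; r = len p + \<epsilon>;
         s = (path_from D (shift D i r) (enc_a D i - r), enc_b D i, - \<sigma>)
     in if r \<le> enc_a D i \<and> syllable D s then Some s else None)"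

primrec descent_iter ::
    "('v, 'e, 'w, 'b, 'k::field) perm_data \<Rightarrow> nat \<Rightarrow> ('w, 'b) triple \<Rightarrow> ('w, 'b) triple option"
  where
    "descent_iter D 0 s = Some s"
  | "descent_iter D (Suc r) s = Option.bind (descent_iter D r s) (descent D)"

end

theory Submission
  imports Defs
begin

text \<open>The arrow ideal is nilpotent modulo the relations. Therefore a component of a commutativity
  relation is maximal, among the nonzero paths of the overquiver, under extension on either side, so
  the component at a source \<open>i\<close> is the path of length \<open>a\<^sub>i\<close>. Lay the orbit out along the overquiver:
  the path of a syllable together with that of its successor (and the arrow skipped between them, if
  the syllable is boundary) is the longest nonzero path from its source, and it is a component
  exactly if the successor is interior. In an interior tail, any two consecutive syllables compose to
  a component. By the pigeonhole principle some syllable path of the tail recurs arbitrarily late, so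
  the orbit can be laid over a translate of its own tail so that the two agree from that syllable on.
  Going backwards, maximality of the components forces each syllable of the orbit to start no later
  than its counterpart in the translated tail, but strictly after the predecessor of that counterpart.
  At the start of the orbit this yields a nonzero path that properly extends the initial syllable to
  the left, contrary to its being injective.\<close>

section \<open>Paths in quivers\<close>

lemma tgt_Nil [simp]: "tgt G (v, []) = v"
  by (simp add: tgt_def pre_digraph.awalk_verts_conv)

lemma tgt_Cons [simp]: "tgt G (v, e # es) = tgt G (head G e, es)"
  by (simp add: tgt_def pre_digraph.awalk_verts_conv)

lemma tgt_app: "tgt G (v, es @ fs) = tgt G (tgt G (v, es), fs)"
  by (induction es arbitrary: v) auto

context wf_digraph
begin

lemma paths_Nil [simp]: "(v, []) \<in> paths G \<longleftrightarrow> v \<in> verts G"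
  by (simp add: paths_def src_def awalk_Nil_iff)

lemma paths_Cons [simp]:
  "(v, e # es) \<in> paths G \<longleftrightarrow> e \<in> arcs G \<and> v = tail G e \<and> (head G e, es) \<in> paths G"
  by (auto simp: paths_def src_def awalk_Cons_iff)

lemma paths_app:
  "(v, es @ fs) \<in> paths G \<longleftrightarrow> (v, es) \<in> paths G \<and> (tgt G (v, es), fs) \<in> paths G"
proof (induction es arbitrary: v)
  case Nil
  have "v \<in> verts G" if "(v, fs) \<in> paths G"
    using that by (cases fs) auto
  then show ?case by auto
qed auto

lemma src_in_verts: "p \<in> paths G \<Longrightarrow> src p \<in> verts G"
  by (auto simp: paths_def awalk_def)

end


section \<open>Ideals containing a power of the arrow ideal\<close>

lemma carrier_path_algebra_single [simp]:
  "Poly_Mapping.single p c \<in> carrier (path_algebra Q) \<longleftrightarrow> p \<in> paths Q \<or> c = 0"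
  by (auto simp: path_algebra_def)

locale nilpotent_quotient = fin_digraph Q
  for Q :: "('v, 'e) pre_digraph" +
  fixes I :: "(('v, 'e) path \<Rightarrow>\<^sub>0 'k::field) set" and m :: nat
  assumes ideal_I: "ideal I (path_algebra Q)"
    and nilpotent: "arrow_ideal Q [^]\<^bsub>ideals_set (path_algebra Q)\<^esub> m \<subseteq> I"
begin

abbreviation R :: "(('v, 'e) path \<Rightarrow>\<^sub>0 'k) ring" where
  "R \<equiv> path_algebra Q"

abbreviation J :: "(('v, 'e) path \<Rightarrow>\<^sub>0 'k) set" where
  "J \<equiv> arrow_ideal Q"

abbreviation Jpow :: "nat \<Rightarrow> (('v, 'e) path \<Rightarrow>\<^sub>0 'k) set" where
  "Jpow n \<equiv> J [^]\<^bsub>ideals_set R\<^esub> n"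

sublocale R: ring R
  by (rule path_algebra_ring) unfold_locales

lemma R_simps [simp]:
  "monoid.mult R = path_mult Q" "add R = (+)" "zero R = 0" "one R = path_scalar Q 1"
  by (simp_all add: path_algebra_def)

lemma I_closed:
  shows I_zero: "0 \<in> I"
    and I_add: "x \<in> I \<Longrightarrow> y \<in> I \<Longrightarrow> x + y \<in> I"
    and I_left: "x \<in> carrier R \<Longrightarrow> y \<in> I \<Longrightarrow> path_mult Q x y \<in> I"
    and I_right: "y \<in> I \<Longrightarrow> x \<in> carrier R \<Longrightarrow> path_mult Q y x \<in> I"
    and I_carrier: "y \<in> I \<Longrightarrow> y \<in> carrier R"
proof -
  interpret I: ideal I R by (rule ideal_I)
  show "0 \<in> I" using I.zero_closed by simp
  show "x \<in> I \<Longrightarrow> y \<in> I \<Longrightarrow> x + y \<in> I" using I.a_closed[of x y] by simp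
  show "x \<in> carrier R \<Longrightarrow> y \<in> I \<Longrightarrow> path_mult Q x y \<in> I" using I.I_l_closed[of y x] by simp
  show "y \<in> I \<Longrightarrow> x \<in> carrier R \<Longrightarrow> path_mult Q y x \<in> I" using I.I_r_closed[of y x] by simp
  show "y \<in> I \<Longrightarrow> y \<in> carrier R" by (rule I.Icarr)
qed

lemma path_scalar_carrier: "path_scalar Q c \<in> carrier R"
proof -
  have "(\<Sum>v\<in>A. Poly_Mapping.single (v, []) c) \<in> carrier R" if "A \<subseteq> verts Q" for A
    using that
  proof (induction A rule: infinite_finite_induct)
    case (insert v A)
    then show ?case
      using R.a_closed[of "Poly_Mapping.single (v, []) c" "\<Sum>v\<in>A. Poly_Mapping.single (v, []) c"]
      by auto
  qed (use R.zero_closed in auto)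
  then show ?thesis by (simp add: path_scalar_def)
qed

lemma path_scalar_mult_single:
  assumes "p \<in> paths Q"
  shows "path_mult Q (path_scalar Q c) (Poly_Mapping.single p d) = Poly_Mapping.single p (c * d)"
  using src_in_verts[OF assms]
  by (simp add: path_scalar_def path_mult_sum_left path_mult_single sum.delta')
    (simp add: src_def)

text \<open>A ring ideal need not be stable under scalars by definition; multiplication by
  \<open>path_scalar Q d\<close> supplies this.\<close>

lemma single_scale_I:
  assumes "p \<in> paths Q" "Poly_Mapping.single p c \<in> I"
  shows "Poly_Mapping.single p (d * c) \<in> I"
  using I_left[OF path_scalar_carrier[of d] assms(2)]
  by (simp only: path_scalar_mult_single[OF assms(1)])

lemma single_I_iff:
  assumes "p \<in> paths Q" "c \<noteq> 0"
  shows "Poly_Mapping.single p c \<in> I \<longleftrightarrow> path_elem p \<in> I"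
  using single_scale_I[OF assms(1), of c "1 / c"] single_scale_I[OF assms(1), of 1 c] assms(2)
  by (auto simp: path_elem_def)

lemma I_uminus: "x \<in> I \<Longrightarrow> - x \<in> I"
proof -
  assume x: "x \<in> I"
  interpret I: ideal I R by (rule ideal_I)
  have "\<ominus>\<^bsub>R\<^esub> x \<in> I" using x by (rule I.a_inv_closed)
  moreover have "x + \<ominus>\<^bsub>R\<^esub> x = 0" using R.r_neg[OF I_carrier[OF x]] by simp
  ultimately show ?thesis by (simp add: eq_neg_iff_add_eq_0 minus_unique)
qed

section \<open>Powers of the arrow ideal and long paths\<close>

lemma J_ideal: "ideal J R"
  unfolding arrow_ideal_def
  by (rule R.genideal_ideal) (auto simp: path_elem_def)

lemma Jpow_0: "Jpow 0 = carrier R"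
  by (simp add: nat_pow_def ideals_set_def)

lemma Jpow_Suc: "Jpow (Suc n) = ideal_prod R (Jpow n) J"
  by (simp add: nat_pow_def ideals_set_def)

lemma single_arrow_J:
  assumes "\<alpha> \<in> arcs Q"
  shows "Poly_Mapping.single (tail Q \<alpha>, [\<alpha>]) c \<in> J"
proof -
  interpret J: ideal J R by (rule J_ideal)
  have "path_elem (tail Q \<alpha>, [\<alpha>]) \<in> J"
    unfolding arrow_ideal_def using assms
    by (intro subsetD[OF R.genideal_self]) (auto simp: path_elem_def)
  moreover have "(tail Q \<alpha>, [\<alpha>]) \<in> paths Q" using assms by simp
  ultimately show ?thesis
    using J.I_l_closed[OF _ path_scalar_carrier[of c]] path_scalar_mult_single[of _ c 1]
    by (fastforce simp: path_elem_def)
qed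

text \<open>Ideal powers grow by a factor \<open>J\<close> on the right, so the path is built up at
  its last arrow.\<close>

lemma single_Jpow:
  assumes "(v, es) \<in> paths Q"
  shows "Poly_Mapping.single (v, es) c \<in> Jpow (length es)"
  using assms
proof (induction es arbitrary: c rule: rev_induct)
  case Nil
  then show ?case by (simp add: Jpow_0 del: nat_pow_0)
next
  case (snoc \<alpha> es)
  have p: "(v, es) \<in> paths Q" "\<alpha> \<in> arcs Q" "tgt Q (v, es) = tail Q \<alpha>"
    using snoc.prems by (auto simp: paths_app)
  have "Poly_Mapping.single (v, es @ [\<alpha>]) c =
      path_mult Q (Poly_Mapping.single (v, es) c) (Poly_Mapping.single (tail Q \<alpha>, [\<alpha>]) 1)"
    using p by (simp add: path_mult_single src_def)
  also have "\<dots> \<in> ideal_prod R (Jpow (length es)) J"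
    using ideal_prod.prod[OF snoc.IH[OF p(1)] single_arrow_J[OF p(2)], of R] by simp
  finally show ?case by (simp only: Jpow_Suc length_append_singleton)
qed

text \<open>The first \<open>m\<close> arrows already give a monomial in \<open>Jpow m\<close>, and
  the ideal absorbs the remaining ones on the right.\<close>

lemma long_path_in_I:
  assumes "p \<in> paths Q" "m \<le> len p"
  shows "Poly_Mapping.single p c \<in> I"
proof -
  obtain v es where p: "p = (v, es)" by (cases p)
  let ?w = "tgt Q (v, take m es)"
  have q: "(v, take m es) \<in> paths Q" "(?w, drop m es) \<in> paths Q"
    using assms(1) paths_app[of v "take m es" "drop m es"] by (auto simp: p)
  have "Poly_Mapping.single p c = path_mult Q (Poly_Mapping.single (v, take m es) c)
      (Poly_Mapping.single (?w, drop m es) 1)"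
    by (simp add: path_mult_single src_def p)
  moreover have "Poly_Mapping.single (v, take m es) c \<in> I"
    using single_Jpow[OF q(1), of c] assms(2) nilpotent by (auto simp: p len_def min_absorb2)
  ultimately show ?thesis using q I_right by auto
qed

section \<open>Cancelling closed paths by nilpotency\<close>

lemma I_cancel:
  assumes "x + y \<in> I" "x \<in> I"
  shows "y \<in> I"
  using I_add[OF assms(1) I_uminus[OF assms(2)]] by simp

text \<open>Modulo \<open>I\<close>, the path \<open>es\<close> is a scalar multiple of
  \<open>us @ es\<close>, hence of any number of copies of \<open>us\<close> followed by
  \<open>es\<close>, and long paths vanish. In the induction an arbitrary closed path
  \<open>fs\<close> at \<open>v\<close> stands for the powers of \<open>us\<close>; the measure is
  the number of arrows that \<open>fs\<close> lacks to reach \<open>m\<close>.\<close>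

lemma nilpotent_left:
  assumes us: "(v, us) \<in> paths Q" "tgt Q (v, us) = v" "us \<noteq> []" and es: "(v, es) \<in> paths Q"
    and rel: "Poly_Mapping.single (v, us @ es) c + Poly_Mapping.single (v, es) d \<in> I" "d \<noteq> 0"
  shows "path_elem (v, es) \<in> I"
proof -
  have "path_elem (v, fs @ es) \<in> I" if "(v, fs) \<in> paths Q" "tgt Q (v, fs) = v" for fs
    using that
  proof (induction "m - length fs" arbitrary: fs rule: less_induct)
    case less
    have p: "(v, fs @ es) \<in> paths Q" using less.prems es by (simp add: paths_app)
    show ?case
    proof (cases "m \<le> length fs")
      case True
      then show ?thesis using long_path_in_I[OF p] by (simp add: len_def path_elem_def)
    next
      case False
      have "path_elem (v, (fs @ us) @ es) \<in> I"
        using less.prems us False by (intro less.hyps) (cases us; auto simp: paths_app tgt_app)+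
      moreover have "(v, (fs @ us) @ es) \<in> paths Q"
        using less.prems us es by (auto simp: paths_app tgt_app)
      ultimately have *: "Poly_Mapping.single (v, fs @ us @ es) c \<in> I"
        using single_I_iff[of "(v, fs @ us @ es)" c] I_zero by (cases "c = 0") auto
      have "path_mult Q (Poly_Mapping.single (v, fs) 1)
          (Poly_Mapping.single (v, us @ es) c + Poly_Mapping.single (v, es) d) \<in> I"
        using rel(1) less.prems by (intro I_left) auto
      then have "Poly_Mapping.single (v, fs @ us @ es) c + Poly_Mapping.single (v, fs @ es) d \<in> I"
        using less.prems by (simp add: path_mult_add_right path_mult_single src_def)
      from I_cancel[OF this *] show ?thesis using single_I_iff[OF p rel(2)] by simp
    qed
  qed
  from this[of "[]"] us show ?thesis using src_in_verts[OF us(1)] by (simp add: src_def)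
qed

text \<open>The mirror image: copies of \<open>us\<close> are inserted at the target of
  \<open>es\<close>, and the relation is multiplied on the right.\<close>

lemma nilpotent_right:
  assumes es: "(v, es) \<in> paths Q" "tgt Q (v, es) = w"
    and us: "(w, us) \<in> paths Q" "tgt Q (w, us) = w" "us \<noteq> []"
    and rel: "Poly_Mapping.single (v, es @ us) c + Poly_Mapping.single (v, es) d \<in> I" "d \<noteq> 0"
  shows "path_elem (v, es) \<in> I"
proof -
  have "path_elem (v, es @ fs) \<in> I" if "(w, fs) \<in> paths Q" "tgt Q (w, fs) = w" for fs
    using that
  proof (induction "m - length fs" arbitrary: fs rule: less_induct)
    case less
    have p: "(v, es @ fs) \<in> paths Q" using less.prems es by (simp add: paths_app)
    show ?case
    proof (cases "m \<le> length fs")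
      case True
      then show ?thesis using long_path_in_I[OF p] by (simp add: len_def path_elem_def)
    next
      case False
      have "path_elem (v, es @ us @ fs) \<in> I"
        using less.prems us False by (intro less.hyps) (cases us; auto simp: paths_app tgt_app)+
      moreover have "(v, es @ us @ fs) \<in> paths Q"
        using less.prems us es by (auto simp: paths_app tgt_app)
      ultimately have *: "Poly_Mapping.single (v, es @ us @ fs) c \<in> I"
        using single_I_iff[of "(v, es @ us @ fs)" c] I_zero by (cases "c = 0") auto
      have "path_mult Q (Poly_Mapping.single (v, es @ us) c + Poly_Mapping.single (v, es) d)
          (Poly_Mapping.single (w, fs) 1) \<in> I"
        using rel(1) less.prems by (intro I_right) auto
      then have "Poly_Mapping.single (v, es @ us @ fs) c + Poly_Mapping.single (v, es @ fs) d \<in> I"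
        using less.prems es us by (simp add: path_mult_add_left path_mult_single src_def tgt_app)
      from I_cancel[OF this *] show ?thesis using single_I_iff[OF p rel(2)] by simp
    qed
  qed
  from this[of "[]"] es show ?thesis using src_in_verts[OF us(1)] by (simp add: src_def)
qed

end

section \<open>Comparison of an orbit with its tail\<close>

text \<open>Positions along a path of the overquiver are natural numbers: \<open>nz x y\<close> and \<open>cp x y\<close> say that
  the subpath from \<open>x\<close> to \<open>y\<close> is nonzero, respectively a component. The \<open>k\<close>th syllable of the orbit
  starts at \<open>W k\<close>. Shifted by the period \<open>c\<close>, the orbit can be compared with its own tail, in which
  consecutive syllables form components; the comparison propagates backwards, in steps of two.\<close>

lemma shifted_zigzag_contradiction:
  fixes W e :: "nat \<Rightarrow> nat" and nz cp :: "nat \<Rightarrow> nat \<Rightarrow> bool" and c A M r :: nat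
  assumes mono: "\<And>k. W k < W (Suc k)" and e: "\<And>k. e k \<le> 1"
    and sub: "\<And>x x' y' y. nz x y \<Longrightarrow> x \<le> x' \<Longrightarrow> x' \<le> y' \<Longrightarrow> y' \<le> y \<Longrightarrow> nz x' y'"
    and cp_nz: "\<And>x y. cp x y \<Longrightarrow> nz x y"
    and cp_max: "\<And>x' x y y'. cp x y \<Longrightarrow> nz x' y' \<Longrightarrow> x' \<le> x \<Longrightarrow> x \<le> y \<Longrightarrow> y \<le> y' \<Longrightarrow>
      x' = x \<and> y' = y"
    and nz_W: "\<And>k. nz (W k + c) (W (k + 2) + c - e (Suc k))"
    and right_max: "\<And>k y. nz (W k + c) y \<Longrightarrow> W k + c \<le> y \<Longrightarrow> y \<le> W (k + 2) + c - e (Suc k)"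
    and cp_W_iff: "\<And>k. cp (W k + c) (W (k + 2) + c - e (Suc k)) \<longleftrightarrow> e (Suc k) = 0"
    and tail: "\<And>k. r \<le> k \<Longrightarrow> cp (W k) (W (k + 2))" and M: "r \<le> M"
    and base: "W A + c = W (Suc (A + M))" "W (Suc A) + c = W (Suc (Suc A + M))"
    and left_max: "\<And>x. nz x (W 1 + c - e 0) \<Longrightarrow> W 0 + c \<le> W 1 + c - e 0 \<Longrightarrow> W 0 + c \<le> x"
  shows False
proof -
  \<comment> \<open>The upper bound is weak because \<open>base\<close> gives equality there at
    \<open>A\<close> and \<open>Suc A\<close>; the lower bound is strict because it must yield a
    proper left extension at index 0.\<close>
  let ?inv = "\<lambda>k. W (k + M) < W k + c \<and> W k + c \<le> W (Suc (k + M))"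
  have step: "?inv k" if inv: "?inv (k + 2)" for k
  proof -
    let ?P = "W k + c" and ?P2 = "W (k + 2) + c" and ?e = "e (Suc k)"
    let ?Q = "W (k + M)" and ?Q1 = "W (k + M + 1)" and ?Q2 = "W (k + M + 2)" and ?Q3 = "W (k + M + 3)"
    have W: "W k < W (k + 1)" "W (k + 1) < W (k + 2)" "?Q < ?Q1" "?Q1 < ?Q2" "?Q2 < ?Q3"
      using mono[of k] mono[of "k + 1"] mono[of "k + M"] mono[of "k + M + 1"] mono[of "k + M + 2"]
      by (simp_all add: numeral_eq_Suc)
    have P2: "?Q2 < ?P2" "?P2 \<le> ?Q3"
      using inv by (simp_all add: numeral_eq_Suc)
    have cps: "cp ?Q ?Q2" "cp ?Q1 ?Q3"
      using tail[of "k + M"] tail[of "k + M + 1"] M by (simp_all add: numeral_eq_Suc)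
    have e': "?e \<le> 1" by (rule e)
    \<comment> \<open>Otherwise the path from \<open>?P\<close> to \<open>?Q3\<close> is a subpath
      of a component, hence nonzero. As no nonzero path from \<open>?P\<close> ends after
      \<open>?P2 - ?e\<close>, and \<open>?P2 \<le> ?Q3\<close>, it follows that
      \<open>?e = 0\<close> and \<open>?P2 = ?Q3\<close>: a component lies properly inside another
      one.\<close>
    have "?P \<le> ?Q1"
    proof (rule ccontr)
      assume less: "\<not> ?P \<le> ?Q1"
      have "nz ?P ?Q3" using sub[OF cp_nz[OF cps(2)]] less W P2 by simp
      then have "?Q3 \<le> ?P2 - ?e" using right_max[of k ?Q3] W P2 by simp
      then have eq: "?e = 0" "?P2 = ?Q3" using P2 W e' by linarith+
      then have "cp ?P ?Q3" using cp_W_iff[of k] by simp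
      from cp_max[OF this cp_nz[OF cps(2)]] show False using less W P2 by simp
    qed
    \<comment> \<open>Otherwise the nonzero path from \<open>?P\<close> to \<open>?P2 - ?e\<close>
      contains the component from \<open>?Q\<close> to \<open>?Q2\<close>; the strict
      \<open>?Q2 < ?P2\<close> makes up for the skipped arrow \<open>?e\<close>. Maximality makes
      the two equal, so \<open>?e = 0\<close> and \<open>?P2 = ?Q2\<close>.\<close>
    moreover have "?Q < ?P"
    proof (rule ccontr)
      assume less: "\<not> ?Q < ?P"
      have le: "?Q2 \<le> ?P2 - ?e" using P2 e' by linarith
      have eq: "?P = ?Q \<and> ?P2 - ?e = ?Q2"
        using cp_max[OF cps(1) nz_W[of k]] less W le by simp
      then have "?e = 0" using cp_W_iff[of k] cps(1) by simp
      then show False using eq P2 by simp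
    qed
    ultimately show ?thesis by simp
  qed
  \<comment> \<open>Since \<open>step\<close> goes back by two indices, two consecutive instances of
    the invariant are carried along.\<close>
  have "?inv (A - k) \<and> ?inv (Suc A - k)" if "k \<le> A" for k
    using that
  proof (induction k)
    case 0
    then show ?case using base mono[of "A + M"] mono[of "Suc A + M"] by simp
  next
    case (Suc k)
    then have "?inv (A - Suc k + 2)" by (simp add: Suc_diff_le numeral_eq_Suc Suc_diff_Suc)
    then have "?inv (A - Suc k)" by (rule step)
    then show ?case using Suc by simp
  qed
  from this[of A] have inv: "?inv 0" "?inv 1" by simp_all
  \<comment> \<open>This component contains the path of the displaced initial syllable, with at
    least one arrow to spare on the left.\<close>
  have cp0: "cp (W M) (W (M + 2))" using M by (rule tail)
  have le: "W 0 + c \<le> W 1 + c - e 0" using mono[of 0] e[of 0] by simp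
  have "W 1 + c - e 0 \<le> W (M + 2)"
    using inv(2) by (intro le_trans[OF diff_le_self]) (simp add: numeral_eq_Suc)
  then have "nz (W M) (W 1 + c - e 0)"
    using sub[OF cp_nz[OF cp0], of "W M" "W 1 + c - e 0"] inv le by simp
  from left_max[OF this le] show False using inv by simp
qed


section \<open>The nonzero paths of the overquiver\<close>

locale permissible =
  fixes D :: "('v, 'e, 'w, 'b, 'k::field) perm_data"
  assumes special_biserial: "special_biserial (quiver D) (relations D)"
    and permissible: "permissible_data D"
begin

abbreviation "Qv \<equiv> quiver D"
abbreviation "Qx \<equiv> ext_quiver D"
abbreviation "Ov \<equiv> overquiver D"
abbreviation "I \<equiv> relations D"
abbreviation "N \<equiv> nonzero_paths D"
abbreviation "C \<equiv> components D"

text \<open>Admissibility yields only the existence of an exponent; fixing one allows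
  \<open>nilpotent_quotient\<close> to be entered as a sublocale.\<close>

definition nilpotency_index :: nat where
  "nilpotency_index = (SOME m. nilpotent_quotient Qv I m)"

sublocale Q: nilpotent_quotient Qv I nilpotency_index
proof -
  have "fin_digraph Qv" "admissible_ideal Qv I"
    using special_biserial by (auto simp: special_biserial_def)
  then have "\<exists>m. nilpotent_quotient Qv I m"
    by (auto simp: admissible_ideal_def nilpotent_quotient_def nilpotent_quotient_axioms_def)
  then show "nilpotent_quotient Qv I nilpotency_index"
    unfolding nilpotency_index_def by (rule someI_ex)
qed

sublocale X: fin_digraph Qx
  using permissible by (auto simp: permissible_data_def regular_quiver_def)

sublocale O: fin_digraph Ov
  using permissible by (auto simp: permissible_data_def regular_quiver_def)

lemma ext_quiver:
  shows verts_ext: "verts Qx = verts Qv"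
    and arcs_ext: "\<alpha> \<in> arcs Qv \<Longrightarrow> \<alpha> \<in> arcs Qx"
    and tail_ext: "\<alpha> \<in> arcs Qv \<Longrightarrow> tail Qx \<alpha> = tail Qv \<alpha>"
    and head_ext: "\<alpha> \<in> arcs Qv \<Longrightarrow> head Qx \<alpha> = head Qv \<alpha>"
  using permissible by (auto simp: permissible_data_def)

lemma overquiver:
  shows vert_map_in: "i \<in> verts Ov \<Longrightarrow> vert_map D i \<in> verts Qv"
    and arc_map_in: "\<alpha> \<in> arcs Ov \<Longrightarrow> arc_map D \<alpha> \<in> arcs Qx"
    and tail_arc_map: "\<alpha> \<in> arcs Ov \<Longrightarrow> tail Qx (arc_map D \<alpha>) = vert_map D (tail Ov \<alpha>)"
    and head_arc_map: "\<alpha> \<in> arcs Ov \<Longrightarrow> head Qx (arc_map D \<alpha>) = vert_map D (head Ov \<alpha>)"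
    and inj_arc_map: "inj_on (arc_map D) (arcs Ov)"
  using permissible by (auto simp: permissible_data_def bij_betw_def)

lemma map_arc_map_inj:
  assumes "map (arc_map D) es = map (arc_map D) fs" "set es \<subseteq> arcs Ov" "set fs \<subseteq> arcs Ov"
  shows "es = fs"
  using assms by (intro map_inj_on[OF assms(1)] inj_on_subset[OF inj_arc_map]) simp

lemma nonzero_path_lifts:
  "p \<in> paths Qx \<Longrightarrow> residue D p \<noteq> \<zero>\<^bsub>alg D\<^esub> \<Longrightarrow> \<exists>p' \<in> paths Ov. path_image D p' = p"
  using permissible by (auto simp: permissible_data_def)

lemma paths_ext_iff: "(v, es) \<in> paths Qv \<longleftrightarrow> (v, es) \<in> paths Qx \<and> set es \<subseteq> arcs Qv"
  by (induction es arbitrary: v) (auto simp: ext_quiver)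

lemma tgt_ext: "(v, es) \<in> paths Qv \<Longrightarrow> tgt Qx (v, es) = tgt Qv (v, es)"
  by (induction es arbitrary: v) (auto simp: ext_quiver)

text \<open>Along the \<open>foldl\<close>, an added arrow contributes residue zero and annihilates
  the product, while products of the remaining cosets are cosets of concatenated paths. Questions
  about residues thus become questions about monomials modulo \<open>I\<close>.\<close>

lemma residue_eq:
  assumes "(v, es) \<in> paths Qx"
  shows "residue D (v, es) =
    (if (v, es) \<in> paths Qv then I +>\<^bsub>Q.R\<^esub> path_elem (v, es) else \<zero>\<^bsub>alg D\<^esub>)"
  using assms
proof (induction es rule: rev_induct)
  case Nil
  then show ?case by (simp add: residue_def vert_residue_def src_def verts_ext)
next
  case (snoc \<alpha> es)
  interpret I: ideal I Q.R by (rule Q.ideal_I)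
  interpret A: ring "alg D" unfolding alg_def by (rule I.quotient_is_ring)
  have es: "(v, es) \<in> paths Qx" "\<alpha> \<in> arcs Qx" "tgt Qx (v, es) = tail Qx \<alpha>"
    using snoc.prems by (auto simp: X.paths_app)
  have carrier: "I +>\<^bsub>Q.R\<^esub> path_elem p \<in> carrier (alg D)" if "p \<in> paths Qv" for p
    using that ring_hom_closed[OF I.rcos_ring_hom, of "path_elem p"]
    by (simp add: alg_def path_elem_def)
  have res: "residue D (v, es @ [\<alpha>]) = residue D (v, es) \<otimes>\<^bsub>alg D\<^esub> arrow_residue D \<alpha>"
    by (simp add: residue_def src_def)
  have arr: "arrow_residue D \<alpha> \<in> carrier (alg D)"
    using carrier[of "(tail Qv \<alpha>, [\<alpha>])"] by (auto simp: arrow_residue_def)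
  show ?case
  proof (cases "(v, es) \<in> paths Qv \<and> \<alpha> \<in> arcs Qv")
    case True
    then have p: "(v, es @ [\<alpha>]) \<in> paths Qv"
      using snoc.prems by (simp add: paths_ext_iff)
    then have t: "tgt Qv (v, es) = tail Qv \<alpha>" by (simp add: Q.paths_app)
    have "residue D (v, es @ [\<alpha>]) =
        (I +>\<^bsub>Q.R\<^esub> path_elem (v, es)) \<otimes>\<^bsub>alg D\<^esub> (I +>\<^bsub>Q.R\<^esub> path_elem (tail Qv \<alpha>, [\<alpha>]))"
      using True by (simp add: res snoc.IH[OF es(1)] arrow_residue_def)
    also have "\<dots> = I +>\<^bsub>Q.R\<^esub> path_mult Qv (path_elem (v, es)) (path_elem (tail Qv \<alpha>, [\<alpha>]))"
      using True I.rcoset_mult_add[of "path_elem (v, es)" "path_elem (tail Qv \<alpha>, [\<alpha>])"]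
      by (simp add: alg_def FactRing_def path_elem_def)
    also have "path_mult Qv (path_elem (v, es)) (path_elem (tail Qv \<alpha>, [\<alpha>])) =
        path_elem (v, es @ [\<alpha>])"
      using t by (simp add: path_elem_def path_mult_single src_def)
    finally show ?thesis using p by simp
  next
    case False
    then have "residue D (v, es) = \<zero>\<^bsub>alg D\<^esub> \<or> arrow_residue D \<alpha> = \<zero>\<^bsub>alg D\<^esub>"
      using snoc.IH[OF es(1)] by (auto simp: arrow_residue_def)
    moreover have "residue D (v, es) \<in> carrier (alg D)"
      using snoc.IH[OF es(1)] carrier[of "(v, es)"] by auto
    ultimately have "residue D (v, es @ [\<alpha>]) = \<zero>\<^bsub>alg D\<^esub>"
      unfolding res using arr A.l_null A.r_null by metis
    moreover have "(v, es @ [\<alpha>]) \<notin> paths Qv" using False by (auto simp: Q.paths_app)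
    ultimately show ?thesis by simp
  qed
qed

lemma coset_eq_zero_iff:
  assumes "x \<in> carrier Q.R"
  shows "I +>\<^bsub>Q.R\<^esub> x = \<zero>\<^bsub>alg D\<^esub> \<longleftrightarrow> x \<in> I"
proof -
  interpret I: ideal I Q.R by (rule Q.ideal_I)
  show ?thesis
    using I.a_rcos_self[OF assms] I.a_rcos_const[of x]
    by (auto simp: alg_def FactRing_def)
qed

lemma residue_nonzero_iff:
  assumes "p \<in> paths Qx"
  shows "residue D p \<noteq> \<zero>\<^bsub>alg D\<^esub> \<longleftrightarrow> p \<in> paths Qv \<and> path_elem p \<notin> I"
  using assms residue_eq[of "fst p" "snd p"] coset_eq_zero_iff[of "path_elem p"]
  by (auto simp: path_elem_def)

lemma path_image_in_paths: "(i, es) \<in> paths Ov \<Longrightarrow> path_image D (i, es) \<in> paths Qx"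
  by (induction es arbitrary: i) (auto simp: path_image_def src_def overquiver verts_ext)

lemma tgt_path_image:
  "(i, es) \<in> paths Ov \<Longrightarrow> tgt Qx (path_image D (i, es)) = vert_map D (tgt Ov (i, es))"
  by (induction es arbitrary: i) (auto simp: path_image_def src_def overquiver)

lemma nonzero_iff:
  "p \<in> N \<longleftrightarrow> p \<in> paths Ov \<and> path_image D p \<in> paths Qv \<and> path_elem (path_image D p) \<notin> I"
  using residue_nonzero_iff[of "path_image D p"] path_image_in_paths[of "fst p" "snd p"]
  by (auto simp: nonzero_paths_def)

lemma linearly_dependentD:
  assumes "p \<in> paths Qv" "q \<in> paths Qv" "linearly_dependent D (residue D p) (residue D q)"
  obtains c d where "c \<noteq> 0 \<or> d \<noteq> 0" "Poly_Mapping.single p c + Poly_Mapping.single q d \<in> I"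
proof -
  interpret I: ideal I Q.R by (rule Q.ideal_I)
  have residue: "residue D p = I +>\<^bsub>Q.R\<^esub> path_elem p" if "p \<in> paths Qv" for p
    using that residue_eq[of "fst p" "snd p"] paths_ext_iff[of "fst p" "snd p"] by simp
  have scale: "scale D c (residue D p) = I +>\<^bsub>Q.R\<^esub> Poly_Mapping.single p c"
    if "p \<in> paths Qv" for c p
    using that I.rcoset_mult_add[OF Q.path_scalar_carrier, of "path_elem p" c]
    by (simp add: residue scale_def alg_def FactRing_def path_elem_def
        Q.path_scalar_mult_single)
  obtain c d where "c \<noteq> 0 \<or> d \<noteq> 0"
    and "scale D c (residue D p) \<oplus>\<^bsub>alg D\<^esub> scale D d (residue D q) = \<zero>\<^bsub>alg D\<^esub>"
    using assms(3) by (auto simp: linearly_dependent_def)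
  moreover have "scale D c (residue D p) \<oplus>\<^bsub>alg D\<^esub> scale D d (residue D q) =
      I +>\<^bsub>Q.R\<^esub> (Poly_Mapping.single p c + Poly_Mapping.single q d)"
    using assms I.a_rcos_sum[of "Poly_Mapping.single p c" "Poly_Mapping.single q d"]
    by (simp add: scale) (simp add: alg_def FactRing_def)
  moreover have "Poly_Mapping.single p c + Poly_Mapping.single q d \<in> carrier Q.R"
    using assms Q.R.a_closed[of "Poly_Mapping.single p c" "Poly_Mapping.single q d"] by simp
  ultimately show ?thesis using that coset_eq_zero_iff by metis
qed

text \<open>If either factor had its image in \<open>I\<close>, so would the product.\<close>

lemma nonzero_append:
  assumes "(i, es @ fs) \<in> N"
  shows "(i, es) \<in> N" "(tgt Ov (i, es), fs) \<in> N"
proof -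
  let ?v = "vert_map D i" and ?es = "map (arc_map D) es" and ?fs = "map (arc_map D) fs"
  let ?w = "vert_map D (tgt Ov (i, es))"
  have O: "(i, es) \<in> paths Ov" "(tgt Ov (i, es), fs) \<in> paths Ov"
    using assms by (auto simp: nonzero_iff O.paths_app)
  have esfs: "(?v, ?es @ ?fs) \<in> paths Qv" "path_elem (?v, ?es @ ?fs) \<notin> I"
    using assms by (auto simp: nonzero_iff path_image_def src_def)
  then have es: "(?v, ?es) \<in> paths Qv" and fs: "(tgt Qv (?v, ?es), ?fs) \<in> paths Qv"
    by (auto simp: Q.paths_app)
  have w: "tgt Qv (?v, ?es) = ?w"
    using tgt_path_image[OF O(1)] tgt_ext[OF es] by (simp add: path_image_def src_def)
  have "path_elem (?v, ?es @ ?fs) = path_mult Qv (path_elem (?v, ?es)) (path_elem (?w, ?fs))"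
    using w by (simp add: path_elem_def path_mult_single src_def)
  then have "path_elem (?v, ?es) \<notin> I" "path_elem (?w, ?fs) \<notin> I"
    using esfs es fs w Q.I_left Q.I_right by (metis carrier_path_algebra_single path_elem_def)+
  then show "(i, es) \<in> N" "(tgt Ov (i, es), fs) \<in> N"
    using O es fs w by (auto simp: nonzero_iff path_image_def src_def)
qed

text \<open>This bound makes the sets under \<open>Max\<close> in the encodings finite, as well as
  the range in the pigeonhole argument.\<close>

lemma nonzero_len: "p \<in> N \<Longrightarrow> len p < nilpotency_index"
  using Q.long_path_in_I[of "path_image D p" 1]
  by (fastforce simp: nonzero_iff path_elem_def path_image_def len_def)


subsection \<open>The overquiver as a permutation of its vertices\<close>

lemma overquiver_degree:
  assumes "i \<in> verts Ov"
  shows "card (out_arcs Ov i) = 1" "card (in_arcs Ov i) = 1"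
  using assms permissible
  by (auto simp: permissible_data_def regular_quiver_def out_degree_def in_degree_def)

lemma out_arc_unique:
  assumes "\<alpha> \<in> arcs Ov" "\<beta> \<in> arcs Ov" "tail Ov \<alpha> = tail Ov \<beta>"
  shows "\<alpha> = \<beta>"
proof -
  have "card (out_arcs Ov (tail Ov \<alpha>)) = 1" using assms by (intro overquiver_degree) auto
  then obtain \<gamma> where \<gamma>: "out_arcs Ov (tail Ov \<alpha>) = {\<gamma>}" by (auto simp: card_1_singleton_iff)
  have "\<alpha> \<in> out_arcs Ov (tail Ov \<alpha>)" "\<beta> \<in> out_arcs Ov (tail Ov \<alpha>)" using assms by auto
  then show ?thesis unfolding \<gamma> by simp
qed

lemma in_arc_unique:
  assumes "\<alpha> \<in> arcs Ov" "\<beta> \<in> arcs Ov" "head Ov \<alpha> = head Ov \<beta>"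
  shows "\<alpha> = \<beta>"
proof -
  have "card (in_arcs Ov (head Ov \<alpha>)) = 1" using assms by (intro overquiver_degree) auto
  then obtain \<gamma> where \<gamma>: "in_arcs Ov (head Ov \<alpha>) = {\<gamma>}" by (auto simp: card_1_singleton_iff)
  have "\<alpha> \<in> in_arcs Ov (head Ov \<alpha>)" "\<beta> \<in> in_arcs Ov (head Ov \<alpha>)" using assms by auto
  then show ?thesis unfolding \<gamma> by simp
qed

lemma out_arc_exists:
  assumes "i \<in> verts Ov"
  obtains \<alpha> where "\<alpha> \<in> arcs Ov" "tail Ov \<alpha> = i"
proof -
  have "out_arcs Ov i \<noteq> {}" using overquiver_degree(1)[OF assms] by force
  then obtain \<alpha> where "\<alpha> \<in> out_arcs Ov i" by blast
  then show ?thesis using that[of \<alpha>] by simp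
qed

lemma path_unique_src:
  assumes "(i, es) \<in> paths Ov" "(i, fs) \<in> paths Ov" "length es = length fs"
  shows "es = fs"
  using assms(3,1,2)
proof (induction es fs arbitrary: i rule: list_induct2)
  case (Cons \<alpha> es \<beta> fs)
  then have "\<alpha> = \<beta>" by (intro out_arc_unique) auto
  with Cons show ?case by auto
qed simp

lemma path_unique_tgt:
  assumes "(i, es) \<in> paths Ov" "(j, fs) \<in> paths Ov" "tgt Ov (i, es) = tgt Ov (j, fs)"
    and "length es = length fs"
  shows "i = j \<and> es = fs"
  using assms(4,1-3)
proof (induction es fs arbitrary: i j rule: rev_induct2)
  case (4 \<alpha> es \<beta> fs)
  then have "\<alpha> = \<beta>" by (intro in_arc_unique) (auto simp: O.paths_app tgt_app)
  with 4 show ?case by (auto simp: O.paths_app)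
qed auto

text \<open>The definite description in \<open>path_from\<close> presupposes existence and
  uniqueness, and both come from out-degree one.\<close>

lemma path_from:
  assumes "i \<in> verts Ov"
  shows "path_from D i r \<in> paths Ov" "src (path_from D i r) = i" "len (path_from D i r) = r"
proof -
  have "\<exists>es. (i, es) \<in> paths Ov \<and> length es = r"
    using assms
  proof (induction r arbitrary: i)
    case (Suc r)
    obtain \<alpha> where \<alpha>: "\<alpha> \<in> arcs Ov" "tail Ov \<alpha> = i" using Suc.prems by (rule out_arc_exists)
    then obtain es where "(head Ov \<alpha>, es) \<in> paths Ov \<and> length es = r"
      using Suc.IH[of "head Ov \<alpha>"] by auto
    then show ?case using \<alpha> by (intro exI[of _ "\<alpha> # es"]) auto
  qed auto
  then have "\<exists>p. p \<in> paths Ov \<and> src p = i \<and> len p = r"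
    by (auto simp: src_def len_def)
  moreover have "p = q" if "p \<in> paths Ov \<and> src p = i \<and> len p = r"
    "q \<in> paths Ov \<and> src q = i \<and> len q = r" for p q
    using that path_unique_src[of i "snd p" "snd q"]
    by (cases p; cases q) (auto simp: src_def len_def)
  ultimately have "\<exists>!p. p \<in> paths Ov \<and> src p = i \<and> len p = r" by blast
  from theI'[OF this]
  show "path_from D i r \<in> paths Ov" "src (path_from D i r) = i" "len (path_from D i r) = r"
    unfolding path_from_def by blast+
qed

lemma path_from_eqI:
  assumes "(i, es) \<in> paths Ov"
  shows "path_from D i (length es) = (i, es)"
proof -
  have i: "i \<in> verts Ov" using O.src_in_verts[OF assms] by (simp add: src_def)
  show ?thesis
    using path_from[OF i, of "length es"] path_unique_src[of i "snd (path_from D i (length es))" es]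
      assms
    by (cases "path_from D i (length es)") (auto simp: src_def len_def)
qed

lemma path_from_obtain:
  assumes "i \<in> verts Ov"
  obtains es where "path_from D i r = (i, es)" "(i, es) \<in> paths Ov" "length es = r"
    "tgt Ov (i, es) = shift D i r"
  using path_from[OF assms, of r] that
  by (cases "path_from D i r") (auto simp: src_def len_def shift_def)

lemma path_from_add:
  assumes "i \<in> verts Ov"
  shows "path_from D i (r + s) = (i, snd (path_from D i r) @ snd (path_from D (shift D i r) s))"
    and "shift D i (r + s) = shift D (shift D i r) s"
proof -
  obtain es where es: "path_from D i r = (i, es)" "(i, es) \<in> paths Ov" "length es = r"
    "tgt Ov (i, es) = shift D i r"
    using assms by (rule path_from_obtain)
  have "shift D i r \<in> verts Ov" using tgt_in_verts[OF O.wf_digraph es(2)] es(4) by simp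
  then obtain fs where fs: "path_from D (shift D i r) s = (shift D i r, fs)"
    "(shift D i r, fs) \<in> paths Ov" "length fs = s"
    "tgt Ov (shift D i r, fs) = shift D (shift D i r) s"
    by (rule path_from_obtain)
  have "(i, es @ fs) \<in> paths Ov" using es fs by (simp add: O.paths_app)
  from path_from_eqI[OF this]
  have *: "path_from D i (r + s) = (i, es @ fs)" using es fs by simp
  then show "path_from D i (r + s) = (i, snd (path_from D i r) @ snd (path_from D (shift D i r) s))"
    using es fs by simp
  show "shift D i (r + s) = shift D (shift D i r) s"
    using * es fs by (subst shift_def) (simp add: tgt_app)
qed

lemma shift_in_verts: "i \<in> verts Ov \<Longrightarrow> shift D i r \<in> verts Ov"
  using path_from(1) tgt_in_verts[OF O.wf_digraph] by (simp add: shift_def)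

lemma shift_0: "i \<in> verts Ov \<Longrightarrow> shift D i 0 = i"
  by (metis path_from_obtain length_0_conv tgt_Nil)

lemma shift_inj:
  assumes "i \<in> verts Ov" "j \<in> verts Ov" "shift D i r = shift D j r"
  shows "i = j"
  using path_unique_tgt assms by (metis path_from_obtain)

lemma path_from_sub:
  assumes "i \<in> verts Ov" "path_from D i (a + b + c) \<in> N"
  shows "path_from D (shift D i a) b \<in> N"
proof -
  obtain es where es: "path_from D i a = (i, es)" "tgt Ov (i, es) = shift D i a"
    using assms(1) by (rule path_from_obtain)
  let ?j = "shift D i a"
  have j: "?j \<in> verts Ov" using assms(1) by (rule shift_in_verts)
  obtain fs where fs: "path_from D ?j b = (?j, fs)" using j by (rule path_from_obtain)
  have "path_from D i (a + (b + c)) \<in> N" using assms(2) by (simp add: add.assoc)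
  then have "(?j, fs @ snd (path_from D (shift D ?j b) c)) \<in> N"
    using nonzero_append(2)[of i es] es fs by (simp add: path_from_add(1)[OF assms(1)] path_from_add(1)[OF j])
  then show ?thesis using nonzero_append(1) fs by simp
qed


subsection \<open>Components are maximal\<close>

text \<open>Neither path lies in \<open>I\<close> on its own, so both coefficients are nonzero. The
  images are parallel because multiplying by the stationary path at an end of one would otherwise
  remove the other monomial.\<close>

lemma component_relation:
  assumes "p \<in> C"
  obtains q c d where "q \<in> N" "path_image D p \<noteq> path_image D q" "c \<noteq> 0" "d \<noteq> 0"
    "Poly_Mapping.single (path_image D p) c + Poly_Mapping.single (path_image D q) d \<in> I"
    "src (path_image D p) = src (path_image D q)"
    "tgt Qv (path_image D p) = tgt Qv (path_image D q)"
proof -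
  let ?p = "path_image D p"
  obtain q where p: "p \<in> N" and q: "q \<in> N" and neq: "?p \<noteq> path_image D q"
    and dep: "linearly_dependent D (residue D ?p) (residue D (path_image D q))"
    using assms by (auto simp: components_def)
  let ?q = "path_image D q"
  have P: "?p \<in> paths Qv" "path_elem ?p \<notin> I" and Q: "?q \<in> paths Qv" "path_elem ?q \<notin> I"
    using p q by (auto simp: nonzero_iff)
  obtain c d where cd: "c \<noteq> 0 \<or> d \<noteq> 0" "Poly_Mapping.single ?p c + Poly_Mapping.single ?q d \<in> I"
    using linearly_dependentD[OF P(1) Q(1) dep] .
  have "c \<noteq> 0" using cd Q Q.single_I_iff[OF Q(1), of d] by auto
  have "d \<noteq> 0" using cd P Q.single_I_iff[OF P(1), of c] by auto
  have notI: "Poly_Mapping.single ?p c \<notin> I" using P Q.single_I_iff[OF P(1) \<open>c \<noteq> 0\<close>] by simp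
  have src: "src ?p = src ?q"
  proof (rule ccontr)
    assume "src ?p \<noteq> src ?q"
    moreover have "path_mult Qv (Poly_Mapping.single (src ?p, []) 1)
        (Poly_Mapping.single ?p c + Poly_Mapping.single ?q d) \<in> I"
      using cd Q.src_in_verts[OF P(1)] by (intro Q.I_left) auto
    ultimately show False
      using notI by (simp add: path_mult_add_right path_mult_single) (simp add: src_def)
  qed
  have tgt: "tgt Qv ?p = tgt Qv ?q"
  proof (rule ccontr)
    assume "tgt Qv ?p \<noteq> tgt Qv ?q"
    moreover have "path_mult Qv (Poly_Mapping.single ?p c + Poly_Mapping.single ?q d)
        (Poly_Mapping.single (tgt Qv ?p, []) 1) \<in> I"
      using cd tgt_in_verts[OF Q.wf_digraph P(1)] by (intro Q.I_right) auto
    ultimately show False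
      using notI by (simp add: path_mult_add_left path_mult_single) (simp add: src_def)
  qed
  show ?thesis by (rule that) fact+
qed

text \<open>In-degree one makes \<open>fs\<close> a suffix of \<open>es\<close>. The part
  \<open>us\<close> before it maps to a closed path, since the images have the same source, and
  \<open>nilpotent_left\<close> puts the shorter path into the ideal.\<close>

lemma relation_distinct_tgt_aux:
  assumes p: "(i, es) \<in> N" and q: "(j, fs) \<in> N"
    and neq: "path_image D (i, es) \<noteq> path_image D (j, fs)" and "d \<noteq> 0"
    and rel: "Poly_Mapping.single (path_image D (i, es)) c +
      Poly_Mapping.single (path_image D (j, fs)) d \<in> I"
    and src: "vert_map D i = vert_map D j" and tgt: "tgt Ov (i, es) = tgt Ov (j, fs)"
    and len: "length fs \<le> length es"
  shows False
proof -
  define us es' where "us = take (length es - length fs) es"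
    and "es' = drop (length es - length fs) es"
  have es: "es = us @ es'" "length es' = length fs" using len by (auto simp: us_def es'_def)
  have us: "(i, us) \<in> paths Ov" "(tgt Ov (i, us), es') \<in> paths Ov"
    using p by (auto simp: nonzero_iff es O.paths_app)
  have "tgt Ov (i, us) = j \<and> es' = fs"
    using us(2) q tgt es by (intro path_unique_tgt) (auto simp: nonzero_iff tgt_app)
  then have j: "tgt Ov (i, us) = j" "es = us @ fs" using es by auto
  have "us \<noteq> []" using j neq src by auto
  let ?v = "vert_map D j" and ?us = "map (arc_map D) us" and ?fs = "map (arc_map D) fs"
  have im: "path_image D (i, es) = (?v, ?us @ ?fs)" "path_image D (j, fs) = (?v, ?fs)"
    using j src by (auto simp: path_image_def src_def)
  have Q: "(?v, ?us) \<in> paths Qv" "(?v, ?fs) \<in> paths Qv" "path_elem (?v, ?fs) \<notin> I"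
    using p q im by (auto simp: nonzero_iff Q.paths_app)
  moreover have "tgt Qv (?v, ?us) = ?v"
    using tgt_path_image[OF us(1)] tgt_ext[OF Q(1)] j src by (simp add: path_image_def src_def)
  ultimately show False
    using Q.nilpotent_left[of ?v ?us ?fs c d] rel \<open>us \<noteq> []\<close> \<open>d \<noteq> 0\<close> im by auto
qed

text \<open>Dually, out-degree one makes \<open>fs\<close> a prefix of \<open>es\<close>, and the
  rest maps to a closed path because the images share their target.\<close>

lemma relation_distinct_src_aux:
  assumes p: "(i, es) \<in> N" and q: "(i, fs) \<in> N"
    and neq: "path_image D (i, es) \<noteq> path_image D (i, fs)" and "d \<noteq> 0"
    and rel: "Poly_Mapping.single (path_image D (i, es)) c +
      Poly_Mapping.single (path_image D (i, fs)) d \<in> I"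
    and tgt: "tgt Qv (path_image D (i, es)) = tgt Qv (path_image D (i, fs))"
    and len: "length fs \<le> length es"
  shows False
proof -
  define es' us where "es' = take (length fs) es" and "us = drop (length fs) es"
  have es: "es = es' @ us" "length es' = length fs" using len by (auto simp: us_def es'_def)
  have "es' = fs"
    using p q es by (intro path_unique_src[of i]) (auto simp: nonzero_iff O.paths_app)
  then have es: "es = fs @ us" using es by simp
  have "us \<noteq> []" using es neq by auto
  let ?v = "vert_map D i" and ?us = "map (arc_map D) us" and ?fs = "map (arc_map D) fs"
  have im: "path_image D (i, es) = (?v, ?fs @ ?us)" "path_image D (i, fs) = (?v, ?fs)"
    using es by (auto simp: path_image_def src_def)
  have Q: "(?v, ?fs @ ?us) \<in> paths Qv" "(?v, ?fs) \<in> paths Qv" "path_elem (?v, ?fs) \<notin> I"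
    using p q im by (auto simp: nonzero_iff)
  let ?w = "tgt Qv (?v, ?fs)"
  have "(?w, ?us) \<in> paths Qv" "tgt Qv (?w, ?us) = ?w"
    using Q(1) tgt im by (auto simp: Q.paths_app tgt_app)
  then show False
    using Q.nilpotent_right[of ?v ?fs ?w ?us c d] Q rel \<open>us \<noteq> []\<close> \<open>d \<noteq> 0\<close> im by auto
qed

text \<open>Were \<open>q\<close> stationary, \<open>p\<close> would map to a closed path of which
  the stationary path is a scalar multiple modulo \<open>I\<close>, so the latter would vanish.
  Nonempty paths have their end vertices fixed by their arrows, which the lifting arguments below
  rely on.\<close>

lemma component_partner_nonstationary:
  assumes p: "p \<in> N" and q: "q \<in> N" and neq: "path_image D p \<noteq> path_image D q" and "d \<noteq> 0"
    and rel: "Poly_Mapping.single (path_image D p) c +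
      Poly_Mapping.single (path_image D q) d \<in> I"
    and src: "src (path_image D p) = src (path_image D q)"
    and tgt: "tgt Qv (path_image D p) = tgt Qv (path_image D q)"
  shows "snd q \<noteq> []"
proof
  assume "snd q = []"
  let ?v = "src (path_image D p)" and ?us = "snd (path_image D p)"
  have im: "path_image D p = (?v, ?us)" by (simp add: src_def)
  have imq: "path_image D q = (?v, [])"
    unfolding src using \<open>snd q = []\<close> by (simp add: path_image_def src_def)
  have us: "?us \<noteq> []" "tgt Qv (?v, ?us) = ?v" using neq im imq tgt by auto
  have "path_elem (?v, []) \<in> I"
    using rel p q \<open>d \<noteq> 0\<close> im imq us
    by (intro Q.nilpotent_left[of ?v ?us "[]" c d]) (auto simp: nonzero_iff)
  then show False using q imq by (simp add: nonzero_iff)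
qed

text \<open>If \<open>p \<alpha> \<noteq> 0\<close> in \<open>A\<close>, then \<open>q \<alpha> \<noteq> 0\<close> for the other component \<open>q\<close>, so that \<open>q \<alpha>\<close> lifts to the
  overquiver. Hence \<open>p\<close> and \<open>q\<close> have the same target there, and one is a proper suffix of the
  other.\<close>

lemma component_no_right_extension:
  assumes p: "(i, es) \<in> C" and ext: "(i, es @ [\<alpha>]) \<in> N"
  shows False
proof -
  let ?p = "path_image D (i, es)" and ?\<alpha> = "arc_map D \<alpha>"
  have pN: "(i, es) \<in> N" using p by (simp add: components_def)
  obtain q c d where q: "q \<in> N" and neq: "?p \<noteq> path_image D q" and c: "c \<noteq> 0" and d: "d \<noteq> 0"
    and rel: "Poly_Mapping.single ?p c + Poly_Mapping.single (path_image D q) d \<in> I"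
    and src: "src ?p = src (path_image D q)"
    and tgt: "tgt Qv ?p = tgt Qv (path_image D q)"
    using p by (rule component_relation)
  obtain j fs where jfs: "q = (j, fs)" by (cases q)
  have fs: "fs \<noteq> []"
    using component_partner_nonstationary[OF pN q neq d rel src tgt] jfs by simp
  let ?v = "vert_map D j" and ?es = "map (arc_map D) es" and ?fs = "map (arc_map D) fs"
  have im: "?p = (?v, ?es)" "path_image D q = (?v, ?fs)"
    "path_image D (i, es @ [\<alpha>]) = (?v, ?es @ [?\<alpha>])"
    using src by (auto simp: path_image_def src_def jfs)
  have E: "(?v, ?es @ [?\<alpha>]) \<in> paths Qv" "path_elem (?v, ?es @ [?\<alpha>]) \<notin> I"
    and F: "(?v, ?fs) \<in> paths Qv"
    using ext q im by (auto simp: nonzero_iff)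
  then have \<alpha>: "?\<alpha> \<in> arcs Qv" "tgt Qv (?v, ?es) = tail Qv ?\<alpha>" by (auto simp: Q.paths_app)
  have t: "tgt Qv (?v, ?fs) = tail Qv ?\<alpha>" using tgt im \<alpha> by simp
  have F': "(?v, ?fs @ [?\<alpha>]) \<in> paths Qv" using F \<alpha> t by (simp add: Q.paths_app)
  have "path_mult Qv (Poly_Mapping.single ?p c + Poly_Mapping.single (path_image D q) d)
      (Poly_Mapping.single (tail Qv ?\<alpha>, [?\<alpha>]) 1) \<in> I"
    using rel \<alpha> by (intro Q.I_right) auto
  then have rel': "Poly_Mapping.single (?v, ?es @ [?\<alpha>]) c +
      Poly_Mapping.single (?v, ?fs @ [?\<alpha>]) d \<in> I"
    using \<alpha> t by (simp add: im path_mult_add_left path_mult_single src_def)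
  have "path_elem (?v, ?fs @ [?\<alpha>]) \<notin> I"
  proof
    assume "path_elem (?v, ?fs @ [?\<alpha>]) \<in> I"
    then have "Poly_Mapping.single (?v, ?fs @ [?\<alpha>]) d \<in> I" using Q.single_I_iff[OF F' d] by simp
    then have "Poly_Mapping.single (?v, ?es @ [?\<alpha>]) c \<in> I"
      using Q.I_cancel rel' by (metis add.commute)
    then show False using E Q.single_I_iff[OF E(1) c] by simp
  qed
  then obtain j' gs where gs: "(j', gs) \<in> paths Ov" "path_image D (j', gs) = (?v, ?fs @ [?\<alpha>])"
    using F' nonzero_path_lifts[of "(?v, ?fs @ [?\<alpha>])"] residue_nonzero_iff[of "(?v, ?fs @ [?\<alpha>])"]
    by (auto simp: paths_ext_iff)
  have "map (arc_map D) gs = map (arc_map D) (fs @ [\<alpha>])"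
    using gs(2) by (simp add: path_image_def)
  moreover have "set gs \<subseteq> arcs Ov" "set (fs @ [\<alpha>]) \<subseteq> arcs Ov"
    using gs(1) q ext by (auto simp: paths_def O.awalk_def jfs nonzero_iff)
  ultimately have "gs = fs @ [\<alpha>]"
    by (rule map_arc_map_inj)
  then have "tgt Ov (j', fs) = tail Ov \<alpha>" using gs(1) by (simp add: O.paths_app)
  \<comment> \<open>The start \<open>j'\<close> of the lift is not compared with \<open>j\<close>:
    the target of a nonempty list of arrows does not depend on the recorded start.\<close>
  then have "tgt Ov (j, fs) = tail Ov \<alpha>" using fs by (cases fs) auto
  moreover have "tgt Ov (i, es) = tail Ov \<alpha>" using ext by (simp add: nonzero_iff O.paths_app)
  ultimately have same: "tgt Ov (i, es) = tgt Ov (j, fs)" by simp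
  have v: "vert_map D i = vert_map D j" using im by (simp add: path_image_def src_def)
  show False
  proof (cases "length fs \<le> length es")
    case True
    then show False
      using relation_distinct_tgt_aux[OF pN q[unfolded jfs] _ d rel[unfolded jfs] v same] neq jfs
      by simp
  next
    case False
    then show False
      using relation_distinct_tgt_aux[OF q[unfolded jfs] pN _ c _ v[symmetric] same[symmetric]]
        neq rel jfs
      by (simp add: add.commute)
  qed
qed

text \<open>The dual argument: the other component also extends to the left by
  \<open>\<alpha>\<close>, so both components start at the head of \<open>\<alpha>\<close> in the
  overquiver, and one is a proper prefix of the other.\<close>

lemma component_no_left_extension:
  assumes p: "(i, es) \<in> C" and ext: "(h, \<alpha> # es) \<in> N"
  shows False
proof -
  let ?p = "path_image D (i, es)" and ?\<alpha> = "arc_map D \<alpha>"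
  have pN: "(i, es) \<in> N" using p by (simp add: components_def)
  obtain q c d where q: "q \<in> N" and neq: "?p \<noteq> path_image D q" and c: "c \<noteq> 0" and d: "d \<noteq> 0"
    and rel: "Poly_Mapping.single ?p c + Poly_Mapping.single (path_image D q) d \<in> I"
    and src: "src ?p = src (path_image D q)"
    and tgt: "tgt Qv ?p = tgt Qv (path_image D q)"
    using p by (rule component_relation)
  obtain j fs where jfs: "q = (j, fs)" by (cases q)
  \<comment> \<open>Here \<open>es\<close> must be nonempty too: the path
    \<open>\<alpha> # es\<close> does not record \<open>i\<close>, so \<open>i\<close> is tied to
    the head of \<open>\<alpha>\<close> only through the first arrow of \<open>es\<close>.\<close>
  have fs: "fs \<noteq> []" and es: "es \<noteq> []"
  proof -
    show "fs \<noteq> []"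
      using component_partner_nonstationary[OF pN q neq d rel src tgt] jfs by simp
    show "es \<noteq> []"
      using component_partner_nonstationary[OF q pN neq[symmetric] c _ src[symmetric] tgt[symmetric]]
        rel by (simp add: add.commute)
  qed
  let ?v = "vert_map D j" and ?es = "map (arc_map D) es" and ?fs = "map (arc_map D) fs"
  let ?u = "vert_map D h"
  have im: "?p = (?v, ?es)" "path_image D q = (?v, ?fs)"
    "path_image D (h, \<alpha> # es) = (?u, ?\<alpha> # ?es)"
    using src by (auto simp: path_image_def src_def jfs)
  have E: "(?u, ?\<alpha> # ?es) \<in> paths Qv" "path_elem (?u, ?\<alpha> # ?es) \<notin> I"
    and P: "(?v, ?es) \<in> paths Qv" and F: "(?v, ?fs) \<in> paths Qv"
    using pN ext q im by (auto simp: nonzero_iff)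
  have \<alpha>: "?\<alpha> \<in> arcs Qv" "?u = tail Qv ?\<alpha>" "head Qv ?\<alpha> = ?v"
    using E(1) P es by (auto simp: neq_Nil_conv)
  have F': "(?u, ?\<alpha> # ?fs) \<in> paths Qv" using F \<alpha> by simp
  have "path_mult Qv (Poly_Mapping.single (tail Qv ?\<alpha>, [?\<alpha>]) 1)
      (Poly_Mapping.single ?p c + Poly_Mapping.single (path_image D q) d) \<in> I"
    using rel \<alpha> Q.src_in_verts[OF F] by (intro Q.I_left) (auto simp: src_def)
  then have rel': "Poly_Mapping.single (?u, ?\<alpha> # ?es) c +
      Poly_Mapping.single (?u, ?\<alpha> # ?fs) d \<in> I"
    using \<alpha> by (simp add: im path_mult_add_right path_mult_single src_def)
  have "path_elem (?u, ?\<alpha> # ?fs) \<notin> I"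
  proof
    assume "path_elem (?u, ?\<alpha> # ?fs) \<in> I"
    then have "Poly_Mapping.single (?u, ?\<alpha> # ?fs) d \<in> I" using Q.single_I_iff[OF F' d] by simp
    then have "Poly_Mapping.single (?u, ?\<alpha> # ?es) c \<in> I"
      using Q.I_cancel rel' by (metis add.commute)
    then show False using E Q.single_I_iff[OF E(1) c] by simp
  qed
  then obtain h' gs where gs: "(h', gs) \<in> paths Ov" "path_image D (h', gs) = (?u, ?\<alpha> # ?fs)"
    using F' nonzero_path_lifts[of "(?u, ?\<alpha> # ?fs)"] residue_nonzero_iff[of "(?u, ?\<alpha> # ?fs)"]
      paths_ext_iff[of ?u "?\<alpha> # ?fs"]
    by auto
  have "map (arc_map D) gs = map (arc_map D) (\<alpha> # fs)"
    using gs(2) by (simp add: path_image_def)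
  moreover have "set gs \<subseteq> arcs Ov" "set (\<alpha> # fs) \<subseteq> arcs Ov"
    using gs(1) q ext by (auto simp: paths_def O.awalk_def jfs nonzero_iff)
  ultimately have "gs = \<alpha> # fs"
    by (rule map_arc_map_inj)
  then have "(head Ov \<alpha>, fs) \<in> paths Ov" using gs(1) by simp
  moreover have "(head Ov \<alpha>, es) \<in> paths Ov" using ext by (simp add: nonzero_iff)
  moreover have "(i, es) \<in> paths Ov" "(j, fs) \<in> paths Ov"
    using pN q jfs by (auto simp: nonzero_iff)
  ultimately have same: "j = i" using es fs by (auto simp: neq_Nil_conv)
  show False
  proof (cases "length fs \<le> length es")
    case True
    then show False
      using relation_distinct_src_aux[OF pN q[unfolded jfs same] _ d rel[unfolded jfs same]]
        neq tgt jfs same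
      by simp
  next
    case False
    then show False
      using relation_distinct_src_aux[OF q[unfolded jfs same] pN _ c] neq rel tgt jfs same
      by (simp add: add.commute)
  qed
qed

text \<open>A proper extension contains an extension by a single arrow on one side, and subpaths of
  nonzero paths are nonzero.\<close>

lemma component_maximal:
  assumes i: "i \<in> verts Ov" and N: "path_from D i (a + l + b) \<in> N"
    and C: "path_from D (shift D i a) l \<in> C"
  shows "a = 0 \<and> b = 0"
proof (rule ccontr)
  assume "\<not> (a = 0 \<and> b = 0)"
  then consider a' where "a = a' + 1" | b' where "b = Suc b'"
    by (metis Suc_eq_plus1 not0_implies_Suc)
  then show False
  proof cases
    case 1
    let ?h = "shift D i a'"
    have h: "?h \<in> verts Ov" using i by (rule shift_in_verts)
    have "path_from D ?h (1 + l) \<in> N"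
      using N 1 by (intro path_from_sub[OF i, where c = b]) (simp add: add.assoc)
    moreover have "shift D ?h 1 = shift D i a" using path_from_add(2)[OF i, of a' 1] 1 by simp
    moreover obtain \<alpha> where "path_from D ?h 1 = (?h, [\<alpha>])"
      using path_from_obtain[OF h, of 1] by (metis One_nat_def length_Suc_conv length_0_conv)
    ultimately have "(?h, \<alpha> # snd (path_from D (shift D i a) l)) \<in> N"
      using path_from_add(1)[OF h, of 1 l] by simp
    moreover have "path_from D (shift D i a) l = (shift D i a, snd (path_from D (shift D i a) l))"
      using path_from(2)[OF shift_in_verts[OF i]] by (metis src_def prod.collapse)
    ultimately show False using component_no_left_extension C by metis
  next
    case 2
    let ?h = "shift D i a"
    have h: "?h \<in> verts Ov" using i by (rule shift_in_verts)
    have "path_from D ?h (l + 1) \<in> N"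
      using N 2 by (intro path_from_sub[OF i, where c = b']) (simp add: add.assoc)
    moreover obtain \<alpha> where "path_from D (shift D ?h l) 1 = (shift D ?h l, [\<alpha>])"
      using path_from_obtain[OF shift_in_verts[OF h], of l 1]
      by (metis One_nat_def length_Suc_conv length_0_conv)
    ultimately have "(?h, snd (path_from D ?h l) @ [\<alpha>]) \<in> N"
      using path_from_add(1)[OF h, of l 1] by simp
    moreover have "path_from D ?h l = (?h, snd (path_from D ?h l))"
      using path_from(2)[OF h] by (metis src_def prod.collapse)
    ultimately show False using component_no_right_extension C by metis
  qed
qed

section \<open>Longest nonzero paths at a vertex\<close>

lemma enc_a:
  assumes "i \<in> verts Ov" "p \<in> N" "src p = i"
  shows "len p \<le> enc_a D i" "path_from D i (enc_a D i) \<in> N"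
proof -
  let ?L = "{len p | p. p \<in> N \<and> src p = i}"
  have fin: "finite ?L" by (rule finite_subset[of _ "{..nilpotency_index}"]) (auto dest: nonzero_len)
  show "len p \<le> enc_a D i" unfolding enc_a_def using assms fin by (intro Max_ge) blast+
  have "Max ?L \<in> ?L" using assms fin by (intro Max_in) blast+
  then obtain q where q: "enc_a D i = len q" "q \<in> N" "src q = i" by (auto simp: enc_a_def)
  then have "path_from D i (enc_a D i) = q"
    using path_from_eqI[of i "snd q"] by (cases q) (auto simp: nonzero_iff src_def len_def)
  then show "path_from D i (enc_a D i) \<in> N" using q by simp
qed

lemma enc_c:
  assumes "p \<in> N"
  shows "len p \<le> enc_c D (tgt Ov p)"
proof -
  have "finite {len q | q. q \<in> N \<and> tgt Ov q = tgt Ov p}"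
    by (rule finite_subset[of _ "{..nilpotency_index}"]) (auto dest: nonzero_len)
  then show ?thesis unfolding enc_c_def using assms by (intro Max_ge) blast+
qed

section \<open>The forward orbit of an injective syllable\<close>

text \<open>The guard in \<open>descent\<close> allows the truncated subtraction to be restated as a
  sum, the form in which lengths add up along the orbit.\<close>

lemma descent_SomeD:
  assumes "descent D s = Some t"
  shows "src (fst s) \<in> verts Ov \<Longrightarrow>
      src (fst t) = shift D (src (fst s)) (len (fst s) + fst (snd s))"
    and "src (fst s) \<in> verts Ov \<Longrightarrow>
      len (fst s) + fst (snd s) + len (fst t) = enc_a D (src (fst s))"
    and "fst (snd t) = enc_b D (src (fst s))"
    and "syllable D t"
  using assms path_from(2,3)[OF shift_in_verts]
  by (auto simp: descent_def Let_def split: if_splits prod.splits)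

lemma no_interior_tail:
  assumes inj: "injective_syllable D p" and orbit: "\<forall>k. descent_iter D k p \<noteq> None"
  shows "\<not> (\<exists>r. \<forall>k\<ge>r. interior (the (descent_iter D k p)))"
proof
  assume "\<exists>r. \<forall>k\<ge>r. interior (the (descent_iter D k p))"
  then obtain r where r: "\<And>k. r \<le> k \<Longrightarrow> interior (the (descent_iter D k p))" by blast
  define s where "s k = the (descent_iter D k p)" for k
  define i l e where "i k = src (fst (s k))" and "l k = len (fst (s k))" and "e k = fst (snd (s k))"
    for k
  \<comment> \<open>The summand \<open>e j\<close> accounts for the arrow skipped after a boundary
    syllable.\<close>
  define W where "W k = (\<Sum>j<k. l j + e j)" for k
  have descent: "descent D (s k) = Some (s (Suc k))" for k
  proof -
    obtain x y where xy: "descent_iter D k p = Some x" "descent_iter D (Suc k) p = Some y"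
      using orbit by blast
    then have "s k = x" "s (Suc k) = y" by (simp_all add: s_def del: descent_iter.simps)
    then show ?thesis using xy by simp
  qed
  have syl: "syllable D (s k)" for k
    using descent_SomeD(4)[OF descent] inj
    by (cases k) (auto simp: s_def injective_syllable_def)
  have N: "fst (s k) \<in> N" and e1: "e k \<le> 1" and pos: "0 < l k + e k" for k
    using syl[of k] by (auto simp: syllable_def l_def e_def split: prod.splits)
  have i: "i k \<in> verts Ov" for k
    using N[of k] O.src_in_verts by (auto simp: i_def nonzero_iff)
  have path: "fst (s k) = path_from D (i k) (l k)" for k
    using path_from_eqI[of "i k" "snd (fst (s k))"] N[of k]
    by (simp add: nonzero_iff i_def l_def src_def len_def)
  have i_Suc: "i (Suc k) = shift D (i k) (l k + e k)"
    and l_Suc: "l k + e k + l (Suc k) = enc_a D (i k)"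
    and e_Suc: "e (Suc k) = enc_b D (i k)" for k
    using descent_SomeD[OF descent[of k]] i[of k] by (auto simp: i_def l_def e_def)
  have e_tail: "e k = 0" if "r \<le> k" for k
    using r[OF that] by (auto simp: e_def s_def interior_def split: prod.splits)
  have W_Suc: "W (Suc k) = W k + l k + e k" for k by (simp add: W_def)
  have W_mono: "W k < W (Suc k)" for k using pos[of k] by (simp add: W_Suc)

  \<comment> \<open>Unrolls the cycle of the overquiver through \<open>i 0\<close>, so that paths
    become intervals of natural numbers.\<close>
  define f where "f x = shift D (i 0) x" for x
  have f_in: "f x \<in> verts Ov" for x unfolding f_def using i by (rule shift_in_verts)
  have f_add: "f (x + y) = shift D (f x) y" for x y
    unfolding f_def using i by (rule path_from_add(2))
  have f_W: "f (W k) = i k" for k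
  proof (induction k)
    case 0
    then show ?case using shift_0[OF i] by (simp add: W_def f_def)
  next
    case (Suc k)
    then show ?case using f_add[of "W k" "l k + e k"] by (simp add: W_Suc i_Suc add.assoc)
  qed

  \<comment> \<open>Source and length determine a path of the overquiver, so finitely many pairs
    describe all syllable paths of the tail.\<close>
  have "infinite {r..}" by (rule infinite_Ici)
  moreover have "finite ((\<lambda>k. (i k, l k)) ` {r..})"
  proof (rule finite_subset)
    show "(\<lambda>k. (i k, l k)) ` {r..} \<subseteq> verts Ov \<times> {..nilpotency_index}"
      using i nonzero_len[OF N] by (auto simp: l_def less_imp_le)
  qed (simp add: O.finite_verts)
  ultimately obtain A where A: "r \<le> A"
    and inf: "infinite {k \<in> {r..}. (i k, l k) = (i A, l A)}"
    using pigeonhole_infinite[of "{r..}" "\<lambda>k. (i k, l k)"] by auto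
  \<comment> \<open>The gap is chosen so large that \<open>r \<le> M\<close>; then every syllable
    \<open>k + M\<close> used in the comparison belongs to the interior tail.\<close>
  obtain B where B: "A + r + 1 \<le> B" "i B = i A" "l B = l A"
    using inf unfolding infinite_nat_iff_unbounded_le by blast
  define M where "M = B - A - 1"
  \<comment> \<open>Displacing the orbit by \<open>c\<close> lays syllable \<open>A\<close> over
    syllable \<open>B\<close>.\<close>
  define c where "c = W B - W A"
  have BM: "B = Suc (A + M)" "r \<le> M" using B(1) by (auto simp: M_def)
  have "W A \<le> W B"
    using lift_Suc_mono_le[of W A B, OF less_imp_le[OF W_mono]] B(1) by simp
  then have c: "W A + c = W B" by (simp add: c_def)
  \<comment> \<open>The walk of length \<open>c\<close> from \<open>i A\<close> returns to
    \<open>i A\<close>; injectivity of \<open>shift\<close> pulls this back to \<open>i 0\<close>,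
    from where it holds at every position.\<close>
  have period: "f (x + c) = f x" for x
  proof -
    have "shift D (f c) (W A) = f (W A)"
      using f_add[of c "W A"] c f_W[of A] f_W[of B] B by (simp add: add.commute)
    moreover have "f (W A) = shift D (f 0) (W A)" using f_add[of 0 "W A"] by simp
    ultimately have "f c = f 0" using shift_inj[OF f_in f_in] by metis
    then show ?thesis using f_add[of c x] f_add[of 0 x] by (simp add: add.commute)
  qed

  define nz where "nz x y \<longleftrightarrow> x \<le> y \<and> path_from D (f x) (y - x) \<in> N" for x y
  define cp where "cp x y \<longleftrightarrow> x \<le> y \<and> path_from D (f x) (y - x) \<in> C" for x y
  \<comment> \<open>The longest nonzero path from \<open>W k + c\<close> covers syllable
    \<open>k\<close>, any arrow skipped after it, and syllable \<open>k + 1\<close>. The arrow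
    possibly skipped after syllable \<open>k + 1\<close> is counted in \<open>W (k + 2)\<close> and
    has to be taken off.\<close>
  define E where "E k = W (k + 2) + c - e (Suc k)" for k
  have E: "E k = W k + c + enc_a D (i k)" for k
    using l_Suc[of k] by (simp add: E_def W_Suc numeral_eq_Suc)
  have f_Wc: "f (W k + c) = i k" for k by (simp add: period f_W)
  have a_max: "len q \<le> enc_a D (i k)" if "q \<in> N" "src q = i k" for q k
    using that i by (intro enc_a) auto
  have a_in: "path_from D (i k) (enc_a D (i k)) \<in> N" for k
    using i N by (intro enc_a[of _ "fst (s k)"]) (auto simp: i_def)
  have sub: "nz x' y'" if nz: "nz x y" and le: "x \<le> x'" "x' \<le> y'" "y' \<le> y" for x x' y' y
  proof -
    obtain a l b where "x' = x + a" "y' = x' + l" "y = y' + b"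
      using le[THEN le_Suc_ex] by blast
    then show ?thesis
      using path_from_sub[OF f_in, of x a l b] nz by (simp add: nz_def f_add add.assoc)
  qed
  have cp_max: "x' = x \<and> y' = y"
    if cp: "cp x y" and nz: "nz x' y'" and le: "x' \<le> x" "x \<le> y" "y \<le> y'" for x' x y y'
  proof -
    obtain a l b where "x = x' + a" "y = x + l" "y' = y + b"
      using le[THEN le_Suc_ex] by blast
    then show ?thesis
      using component_maximal[OF f_in, of x' a l b] cp nz
      by (simp add: nz_def cp_def f_add add.assoc)
  qed
  have nz_W: "nz (W k + c) (E k)" for k
    using a_in[of k] by (simp add: nz_def E f_Wc)
  have right_max: "y \<le> E k" if "nz (W k + c) y" "W k + c \<le> y" for k y
    using a_max[of "path_from D (i k) (y - (W k + c))" k] that path_from(2,3)[OF i]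
    by (simp add: nz_def f_Wc E)
  have cp_W_iff: "cp (W k + c) (E k) \<longleftrightarrow> e (Suc k) = 0" for k
  proof
    assume "cp (W k + c) (E k)"
    then have "path_from D (i k) (enc_a D (i k)) \<in> C" by (simp add: cp_def E f_Wc)
    then show "e (Suc k) = 0" using path_from(2)[OF i] by (auto simp: e_Suc enc_b_def)
  next
    \<comment> \<open>The definition of \<open>enc_b\<close> provides only some component starting
      at \<open>i k\<close>; maximality identifies it with the longest nonzero path.\<close>
    assume "e (Suc k) = 0"
    then obtain q where q: "q \<in> C" "src q = i k" by (auto simp: e_Suc enc_b_def split: if_splits)
    then have qN: "q \<in> N" by (simp add: components_def)
    have "q = path_from D (i k) (len q)"
      using q qN path_from_eqI[of "i k" "snd q"] by (cases q) (auto simp: nonzero_iff src_def len_def)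
    then have "cp (W k + c) (W k + c + len q)" using q by (simp add: cp_def f_Wc)
    from cp_max[OF this nz_W[of k]] show "cp (W k + c) (E k)"
      using a_max[OF qN q(2)] \<open>cp (W k + c) (W k + c + len q)\<close> by (simp add: E)
  qed
  have tail: "cp (W k) (W (k + 2))" if "r \<le> k" for k
  proof -
    have "e (Suc k) = 0" using that by (intro e_tail) simp
    then have "cp (W k + c) (W (k + 2) + c)" using cp_W_iff[of k] by (simp add: E_def)
    then show ?thesis by (simp add: cp_def f_Wc f_W)
  qed
  \<comment> \<open>The starts after \<open>A\<close> and \<open>B\<close> coincide as well: the
    lengths agree, and no arrow is skipped in the tail.\<close>
  have base: "W (Suc A) + c = W (Suc (Suc A + M))"
    using c B BM(1) A by (simp add: W_Suc[of A] W_Suc[of B, unfolded BM(1)] BM(1) e_tail)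
  \<comment> \<open>By periodicity such a path ends at the target of the initial syllable, and
    injectivity of that syllable bounds its length by \<open>enc_c\<close>, which equals
    \<open>l 0\<close>.\<close>
  have left_max: "W 0 + c \<le> x"
    if nz: "nz x (W 1 + c - e 0)" and le: "W 0 + c \<le> W 1 + c - e 0" for x
  proof -
    let ?y = "W 1 + c - e 0" and ?q = "path_from D (f x) (W 1 + c - e 0 - x)"
    have y: "?y = c + l 0" by (simp add: W_def)
    have x: "x \<le> ?y" "?q \<in> N" using nz by (auto simp: nz_def)
    have "tgt Ov ?q = f (x + (?y - x))" using f_add[of x] by (simp add: shift_def)
    also have "\<dots> = f (l 0)" using x(1) y period[of "l 0"] by (simp add: add.commute)
    also have "\<dots> = tgt Ov (fst (s 0))" using path[of 0] by (simp add: f_def shift_def)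
    finally have "len ?q \<le> enc_c D (tgt Ov (fst (s 0)))" using enc_c[OF x(2)] by simp
    also have "\<dots> = l 0" using inj by (auto simp: injective_syllable_def s_def l_def)
    finally have "?y - x \<le> l 0" using path_from(3)[OF f_in] by simp
    then show ?thesis using y by (simp add: W_def)
  qed
  show False
  proof (rule shifted_zigzag_contradiction[of W e nz cp c r M A])
    show "cp x y \<Longrightarrow> nz x y" for x y by (auto simp: cp_def nz_def components_def)
    show "W A + c = W (Suc (A + M))" using c BM by simp
  qed (use W_mono e1 sub cp_max nz_W right_max cp_W_iff tail BM(2) base left_max in
      \<open>auto simp: E_def\<close>)
qed

end

theorem mainTheorem3:
  fixes D :: "('v, 'e, 'w, 'b, 'k::alg_closed_field) perm_data"
    and \<p> :: "('w, 'b) triple"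
  assumes "special_biserial (quiver D) (relations D)"
    and "permissible_data D"
    and "injective_syllable D \<p>"
    and "\<forall>r. descent_iter D r \<p> \<noteq> None"
  shows "\<not> (\<exists>R. \<forall>r \<ge> R. interior (the (descent_iter D r \<p>)))"
proof -
  interpret permissible D using assms(1,2) by unfold_locales
  show ?thesis using assms(3,4) by (rule no_interior_tail)
qed

end
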